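(* Let $G$ act by isometries on a Gromov hyperbolic space $X$, and let $\mu$ be a countable non-elementary probability measure on $G$ whose support is bounded in $X$. Then for almost every sample path $$\lim_{n\to\infty}\frac{\tau(w_n)}{n}=L,$$ where $L>0$ is the drift of the random walk, i.e. the almost sure limit $L=\lim_n d(x,w_nx)/n$.
   Context: $X$ is $\delta$-hyperbolic geodesic, not necessarily proper, basepoint $x$. Translation length $\tau(g)=\lim_n d(x,g^nx)/n$. Non-elementary: the semigroup generated by $\mathrm{supp}\mu$ contains two loxodromic ($\tau>0$) elements with disjoint fixed point sets in $\partial X$. Bounded support: $\{gx:g\in\mathrm{supp}\mu\}$ bounded. $w_n=g_1\cdots g_n$, $g_i$ i.i.d. $\sim\mu$; for such $\mu$ the drift limit exists a.s. and is positive. *)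

theory Defs
  imports "HOL-Probability.Probability" "HOL-Algebra.Group"
begin

definition gromov_product :: "'a::metric_space \<Rightarrow> 'a \<Rightarrow> 'a \<Rightarrow> real" where
  "gromov_product w y z = (dist w y + dist w z - dist y z) / 2"

definition geodesic_space :: "'a::metric_space itself \<Rightarrow> bool" where
  "geodesic_space _ \<longleftrightarrow> (\<forall>y z::'a. \<exists>\<gamma>::real \<Rightarrow> 'a. \<gamma> 0 = y \<and> \<gamma> (dist y z) = z \<and>
      (\<forall>s\<in>{0..dist y z}. \<forall>t\<in>{0..dist y z}. dist (\<gamma> s) (\<gamma> t) = \<bar>s - t\<bar>))"

definition delta_hyperbolic :: "real \<Rightarrow> 'a::metric_space itself \<Rightarrow> bool" where
  "delta_hyperbolic \<delta> _ \<longleftrightarrow> (\<forall>w y z v::'a.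
      gromov_product w y z \<ge> min (gromov_product w y v) (gromov_product w v z) - \<delta>)"

definition conv_infty :: "'a::metric_space \<Rightarrow> (nat \<Rightarrow> 'a) \<Rightarrow> bool" where
  "conv_infty x u \<longleftrightarrow> (\<forall>M. \<exists>N. \<forall>m\<ge>N. \<forall>n\<ge>N. gromov_product x (u m) (u n) \<ge> M)"

definition bequiv :: "'a::metric_space \<Rightarrow> (nat \<Rightarrow> 'a) \<Rightarrow> (nat \<Rightarrow> 'a) \<Rightarrow> bool" where
  "bequiv x u v \<longleftrightarrow> (\<forall>M. \<exists>N. \<forall>m\<ge>N. \<forall>n\<ge>N. gromov_product x (u m) (v n) \<ge> M)"

definition bpoint :: "'a::metric_space \<Rightarrow> (nat \<Rightarrow> 'a) \<Rightarrow> (nat \<Rightarrow> 'a) set" where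
  "bpoint x u = {v. conv_infty x v \<and> bequiv x u v}"

definition gromov_boundary :: "'a::metric_space \<Rightarrow> (nat \<Rightarrow> 'a) set set" where
  "gromov_boundary x = {bpoint x u | u. conv_infty x u}"

definition boundary_fixpoints :: "'a::metric_space \<Rightarrow> ('a \<Rightarrow> 'a) \<Rightarrow> (nat \<Rightarrow> 'a) set set" where
  "boundary_fixpoints x f = {bpoint x u | u. conv_infty x u \<and> bpoint x (f \<circ> u) = bpoint x u}"

definition isometric_action ::
  "('g, 'b) monoid_scheme \<Rightarrow> ('g \<Rightarrow> 'a::metric_space \<Rightarrow> 'a) \<Rightarrow> bool" where
  "isometric_action G act \<longleftrightarrow>
     (\<forall>g\<in>carrier G. \<forall>y z. dist (act g y) (act g z) = dist y z) \<and>
     act \<one>\<^bsub>G\<^esub> = id \<and>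
     (\<forall>g\<in>carrier G. \<forall>h\<in>carrier G. act (g \<otimes>\<^bsub>G\<^esub> h) = act g \<circ> act h)"

definition transl_len ::
  "('g, 'b) monoid_scheme \<Rightarrow> ('g \<Rightarrow> 'a::metric_space \<Rightarrow> 'a) \<Rightarrow> 'a \<Rightarrow> 'g \<Rightarrow> real" where
  "transl_len G act x g = lim (\<lambda>n. dist x (act (g [^]\<^bsub>G\<^esub> n) x) / real n)"

definition gprod :: "('g, 'b) monoid_scheme \<Rightarrow> 'g list \<Rightarrow> 'g" where
  "gprod G l = foldr (\<lambda>g h. g \<otimes>\<^bsub>G\<^esub> h) l \<one>\<^bsub>G\<^esub>"

definition gen_semigroup :: "('g, 'b) monoid_scheme \<Rightarrow> 'g set \<Rightarrow> 'g set" where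
  "gen_semigroup G S = {gprod G l | l. l \<noteq> [] \<and> set l \<subseteq> S}"

definition non_elementary ::
  "('g, 'b) monoid_scheme \<Rightarrow> ('g \<Rightarrow> 'a::metric_space \<Rightarrow> 'a) \<Rightarrow> 'a \<Rightarrow> 'g pmf \<Rightarrow> bool" where
  "non_elementary G act x \<mu> \<longleftrightarrow>
     (\<exists>g\<in>gen_semigroup G (set_pmf \<mu>). \<exists>h\<in>gen_semigroup G (set_pmf \<mu>).
        transl_len G act x g > 0 \<and> transl_len G act x h > 0 \<and>
        boundary_fixpoints x (act g) \<inter> boundary_fixpoints x (act h) = {})"

definition rw_pos :: "('g, 'b) monoid_scheme \<Rightarrow> 'g stream \<Rightarrow> nat \<Rightarrow> 'g" where
  "rw_pos G \<omega> n = gprod G (stake n \<omega>)"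

end

theory Submission
  imports Defs
begin

text \<open>
  Write \<open>|g| = d(x, gx)\<close>, let \<open>(y | z)\<close> be the Gromov product based at \<open>x\<close>, and let \<open>w\<^sub>n\<close> be the random walk.
  High powers \<open>a, b\<close> of two independent loxodromic elements play ping-pong, so among the \<open>2\<^sup>k\<close> words of
  length \<open>k\<close> in \<open>a, b\<close> at most \<open>k + 1\<close> move a given \<open>z\<close> close to (or in the direction of) a given \<open>y\<close>. A
  maximum principle turns this into a uniform estimate: for suitable \<open>N\<close> and \<open>C\<close>, all \<open>y, z\<close> satisfy
  \<open>P((w\<^sub>N\<^sup>-\<^sup>1y | z) > C) \<le> 3/8\<close>, and likewise for \<open>P(|w\<^sub>N| \<le> r)\<close>. Together the two show that
  \<open>E[d(y, w\<^sub>M x) - d(y, x)] \<ge> 1\<close> for some \<open>M\<close> and all \<open>y\<close>. As the steps are bounded and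
  \<open>d(y, wx) - d(y, x)\<close> is a cocycle, \<open>E exp(-s (d(y, w\<^sub>n x) - d(y, x)))\<close> decays exponentially for small
  \<open>s\<close>, uniformly in \<open>y\<close>; conditioning on a first block of steps, hyperbolicity then bounds
  \<open>E exp(s (y | w\<^sub>n x))\<close> uniformly in \<open>n\<close> and \<open>y\<close>.

  Consequently \<open>E[d(y, w\<^sub>n x) - d(y, x)]\<close> differs from \<open>E|w\<^sub>n|\<close> by a bounded amount, so with
  \<open>L = lim E|w\<^sub>n|/n > 0\<close> the Chernoff and Borel-Cantelli arguments give \<open>|w\<^sub>n|/n \<rightarrow> L\<close> almost surely. Finally
  split \<open>w\<^sub>n = ab\<close> into independent halves: the products \<open>(a\<^sup>-\<^sup>1x | bx)\<close> and \<open>(ax | b\<^sup>-\<^sup>1x)\<close> are almost surely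
  \<open>o(n)\<close>, whence so is \<open>(w\<^sub>n x | w\<^sub>n\<^sup>-\<^sup>1x)\<close>, and \<open>\<tau>(g) \<ge> |g| - 2 (gx | g\<^sup>-\<^sup>1x) - 2\<delta>\<close> yields the claim.
\<close>

text \<open>The limit is the infimum of \<open>a n / real n\<close> over positive \<open>n\<close>,
  so the second conclusion holds for each single \<open>n\<close>. Convergence follows by dividing
  \<open>n\<close> with remainder by an \<open>m\<close> that nearly attains the infimum.\<close>

lemma fekete:
  fixes a :: "nat \<Rightarrow> real"
  assumes sub: "\<And>m n. a (m + n) \<le> a m + a n" and nonneg: "\<And>n. 0 \<le> a n"
  obtains l where "(\<lambda>n. a n / real n) \<longlonglongrightarrow> l" "\<And>n. real n * l \<le> a n"
proof -
  define l where "l = (INF n\<in>{0<..}. a n / real n)"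
  have bdd: "bdd_below ((\<lambda>n. a n / real n) ` {0<..})"
    by (rule bdd_belowI[of _ 0]) (use nonneg in auto)
  have le: "l \<le> a n / real n" if "n > 0" for n
    unfolding l_def using that by (intro cINF_lower bdd) auto
  have mult: "a (q * m + r) \<le> real q * a m + a r" for q m r
  proof (induction q)
    case (Suc q)
    have "a (Suc q * m + r) \<le> a m + a (q * m + r)"
      using sub[of m "q * m + r"] by (simp add: add.assoc)
    then show ?case using Suc by (simp add: algebra_simps)
  qed simp
  have "(\<lambda>n. a n / real n) \<longlonglongrightarrow> l"
  proof (rule LIMSEQ_I)
    fix e :: real assume e: "e > 0"
    have "\<exists>m\<in>{0<..}. a m / real m < l + e / 2"
      using e bdd cINF_less_iff[OF _ bdd, of "l + e / 2"] unfolding l_def by fastforce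
    then obtain m where m: "m > 0" "a m / real m < l + e / 2" by auto
    define K where "K = (\<Sum>r<m. a r)"
    have K: "a r \<le> K" if "r < m" for r
      unfolding K_def using that nonneg by (intro member_le_sum) auto
    have K0: "0 \<le> K" unfolding K_def by (intro sum_nonneg nonneg)
    obtain N :: nat where N: "real N > 2 * K / e" using reals_Archimedean2 by blast
    show "\<exists>N. \<forall>n\<ge>N. norm (a n / real n - l) < e"
    proof (intro exI allI impI)
      fix n assume n: "n \<ge> Suc N"
      have n0: "n > 0" using n by simp
      have "a n \<le> real (n div m) * a m + a (n mod m)"
        using mult[of "n div m" m "n mod m"] by simp
      also have "\<dots> \<le> real (n div m) * a m + K"
        using K m by simp
      also have "real (n div m) * a m = (real (n div m) * real m) * (a m / real m)"
        using m by simp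
      also have "\<dots> \<le> real n * (a m / real m)"
      proof (rule mult_right_mono)
        show "real (n div m) * real m \<le> real n"
          by (metis div_times_less_eq_dividend of_nat_le_iff of_nat_mult)
      qed (use nonneg in auto)
      finally have "a n / real n \<le> a m / real m + K / real n"
        using n0 by (simp add: field_simps)
      moreover have "K / real n < e / 2"
      proof -
        have "2 * K / e < real n" using N n by linarith
        then show ?thesis using e n0 by (simp add: field_simps)
      qed
      ultimately have "a n / real n < l + e" using m(2) by linarith
      then show "norm (a n / real n - l) < e"
        using le[OF n0] by simp
    qed
  qed
  moreover have "real n * l \<le> a n" for n
    using le[of n] nonneg[of n] by (cases "n = 0") (auto simp: field_simps)
  ultimately show thesis by (rule that)
qed

section \<open>Elementary properties of the Gromov product\<close>

lemma gromov_product_commute: "gromov_product w y z = gromov_product w z y"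
  by (simp add: gromov_product_def dist_commute)

lemma gromov_product_nonneg: "0 \<le> gromov_product w y z"
  unfolding gromov_product_def using dist_triangle[of y z w] by (simp add: dist_commute)

lemma gromov_product_le: "gromov_product w y z \<le> dist w y" "gromov_product w y z \<le> dist w z"
  unfolding gromov_product_def using dist_triangle[of w z y] dist_triangle[of w y z]
  by (simp_all add: dist_commute)

lemma gromov_product_move_point: "gromov_product w y z \<le> gromov_product w y' z + dist y y'"
  unfolding gromov_product_def using dist_triangle[of w y y'] dist_triangle[of y' z y]
  by (simp add: dist_commute field_simps)

lemma gromov_product_move_base: "gromov_product w y z \<le> gromov_product w' y z + dist w w'"
  unfolding gromov_product_def using dist_triangle[of w y w'] dist_triangle[of w z w']
  by (simp add: field_simps)

text \<open>In the tripod that models the triangle \<open>w\<close>, \<open>y\<close>,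
  \<open>z\<close>, these are the two pieces into which the branch point cuts the side from
  \<open>w\<close> to \<open>y\<close>.\<close>

lemma gromov_product_complement: "gromov_product w y z + gromov_product y w z = dist w y"
  unfolding gromov_product_def by (simp add: dist_commute field_simps)

section \<open>Isometries of hyperbolic spaces\<close>

locale hyperbolic_action = group G for G :: "('g, 'b) monoid_scheme" (structure) +
  fixes act :: "'g \<Rightarrow> 'a::metric_space \<Rightarrow> 'a" and x :: 'a and \<delta> :: real
  assumes action: "isometric_action G act"
    and hyperbolic: "delta_hyperbolic \<delta> TYPE('a)"
begin

abbreviation gp :: "'a \<Rightarrow> 'a \<Rightarrow> real" where "gp \<equiv> gromov_product x"
abbreviation len :: "'g \<Rightarrow> real" where "len g \<equiv> dist x (act g x)"

lemma gp_hyp: "min (gromov_product w y v) (gromov_product w v z) - \<delta> \<le> gromov_product w y z"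
  for w y z v :: 'a
  using hyperbolic unfolding delta_hyperbolic_def by blast

lemma delta_nonneg: "0 \<le> \<delta>"
  using gp_hyp[of x x x x] by simp

lemma gp_hyp2: "min (gp y v) (min (gp v u) (gp u z)) - 2 * \<delta> \<le> gp y z"
  using gp_hyp[of x y v z] gp_hyp[of x v u z] delta_nonneg by linarith

text \<open>Hyperbolicity at the base point \<open>p\<close>, multiplied out: of the three ways to
  pair off four points, the two largest distance sums differ by at most 2\<delta>.\<close>

lemma four_point:
  "dist p r + dist q s \<le> max (dist p q + dist r s) (dist p s + dist q r) + 2 * \<delta>" for p q r s :: 'a
  using gp_hyp[of p q r s] unfolding gromov_product_def
  by (simp add: dist_commute min_def max_def field_simps split: if_splits)

lemma act_mult: "g \<in> carrier G \<Longrightarrow> h \<in> carrier G \<Longrightarrow> act (g \<otimes> h) y = act g (act h y)"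
  using action unfolding isometric_action_def by simp

lemma act_one [simp]: "act \<one> y = y"
  using action unfolding isometric_action_def by simp

lemma dist_act [simp]: "g \<in> carrier G \<Longrightarrow> dist (act g y) (act g z) = dist y z"
  using action unfolding isometric_action_def by simp

lemma act_inv_act [simp]: "g \<in> carrier G \<Longrightarrow> act (inv g) (act g y) = y"
  using act_mult[of "inv g" g y] by simp

lemma act_act_inv [simp]: "g \<in> carrier G \<Longrightarrow> act g (act (inv g) y) = y"
  using act_mult[of g "inv g" y] by simp

lemma dist_act_inv: "g \<in> carrier G \<Longrightarrow> dist (act (inv g) y) z = dist y (act g z)"
  using dist_act[of g "act (inv g) y" z] by simp

lemma len_inv [simp]: "g \<in> carrier G \<Longrightarrow> len (inv g) = len g"
  using dist_act_inv[of g x x] by (simp add: dist_commute)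

lemma len_mult: "g \<in> carrier G \<Longrightarrow> h \<in> carrier G \<Longrightarrow> len (g \<otimes> h) \<le> len g + len h"
  using dist_triangle[of x "act (g \<otimes> h) x" "act g x"] by (simp add: act_mult)

lemma gromov_product_act [simp]:
  "g \<in> carrier G \<Longrightarrow> gromov_product (act g w) (act g y) (act g z) = gromov_product w y z"
  by (simp add: gromov_product_def)

text \<open>The complement identity for the side from \<open>x\<close> to \<open>act g x\<close>,
  moved by \<open>inv g\<close>. It drives the ping-pong: a point whose product with
  \<open>act g x\<close> is small goes under \<open>inv g\<close> to a point whose product with
  \<open>act (inv g) x\<close> is nearly \<open>len g\<close>.\<close>

lemma gp_complement_inv:
  assumes "g \<in> carrier G"
  shows "gp (act (inv g) y) (act (inv g) x) = len g - gp y (act g x)"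
  using gromov_product_complement[of x "act g x" y] gromov_product_act[of "inv g" "act g x" x y] assms
  by (simp add: gromov_product_commute)

lemma gp_act_inv_le:
  assumes "g \<in> carrier G" shows "gp (act (inv g) u) z \<le> gp u (act g z) + len g"
  using gromov_product_move_base[of x "act (inv g) u" z "act (inv g) x"] assms
    gromov_product_act[of "inv g" x u "act g z"] by simp

lemma dist_pow:
  "g \<in> carrier G \<Longrightarrow> dist (act (g [^] (m::nat)) x) (act (g [^] (m + n)) x) = len (g [^] n)"
  by (simp flip: nat_pow_mult add: act_mult)

lemma len_pow_add:
  "g \<in> carrier G \<Longrightarrow> len (g [^] (m + n :: nat)) \<le> len (g [^] m) + len (g [^] n)"
  using len_mult[of "g [^] m" "g [^] n"] by (simp add: nat_pow_mult)

text \<open>\<open>transl_len\<close> is a \<open>lim\<close>, so its value is accessible only once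
  convergence is known. Lengths of powers are subadditive, and Fekete's lemma gives both the limit
  and the bound at finite \<open>n\<close>.\<close>

lemma transl_len_limit:
  assumes g: "g \<in> carrier G"
  shows "(\<lambda>n. len (g [^] n) / real n) \<longlonglongrightarrow> transl_len G act x g"
    and "real n * transl_len G act x g \<le> len (g [^] n)"
proof -
  obtain l where l: "(\<lambda>n. len (g [^] n) / real n) \<longlonglongrightarrow> l" "\<And>n. real n * l \<le> len (g [^] n)"
    using fekete[of "\<lambda>n. len (g [^] n)"] len_pow_add[OF g] by (metis zero_le_dist)
  have "transl_len G act x g = l"
    unfolding transl_len_def using l(1) by (rule limI)
  with l show "(\<lambda>n. len (g [^] n) / real n) \<longlonglongrightarrow> transl_len G act x g"
    and "real n * transl_len G act x g \<le> len (g [^] n)" by auto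
qed

lemma transl_len_le: "g \<in> carrier G \<Longrightarrow> transl_len G act x g \<le> len g"
  using transl_len_limit(2)[of g 1] by simp

lemma transl_len_nonneg:
  assumes "g \<in> carrier G" shows "0 \<le> transl_len G act x g"
  by (rule LIMSEQ_le_const[OF transl_len_limit(1)[OF assms]]) auto

text \<open>Induction with the four-point inequality for x, gx, g^2 x, g^(k+2) x. If the maximum
  were its first argument, \<open>len (g [^] Suc k)\<close> would be at most
  \<open>len (g [^] k) - c\<close>, against the induction hypothesis and
  \<open>c > 0\<close>.\<close>

lemma len_pow_step:
  assumes g: "g \<in> carrier G" and c: "c = len (g [^] (2::nat)) - len g - 2 * \<delta>" "c > 0"
  shows "len (g [^] k) + c \<le> len (g [^] Suc k)"
proof (induction k)
  case 0
  have "len (g [^] (2::nat)) \<le> len g + len g" using len_pow_add[OF g, of 1 1] g by (simp add: numeral_2_eq_2)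
  then show ?case using c delta_nonneg g by simp
next
  case (Suc k)
  have "len (g [^] (2::nat)) + len (g [^] Suc k)
      \<le> max (len g + len (g [^] k)) (len (g [^] Suc (Suc k)) + len g) + 2 * \<delta>"
    using four_point[of x "act (g [^] (2::nat)) x" "act (g [^] (1::nat)) x" "act (g [^] Suc (Suc k)) x"]
      dist_pow[OF g, of 1 "Suc k"] dist_pow[OF g, of 2 k] dist_pow[OF g, of 1 1] g
    by (simp add: numeral_2_eq_2)
  then show ?case using Suc c by (simp add: max_def split: if_splits)
qed

text \<open>Since \<open>d(x, g\<^sup>2x) = 2 d(x, gx) - 2 (gx | g\<^sup>-\<^sup>1x)\<close>, this follows from the linear growth
  \<open>d(x, g\<^sup>k\<^sup>+\<^sup>1x) \<ge> d(x, g\<^sup>kx) + d(x, g\<^sup>2x) - d(x, gx) - 2\<delta>\<close>.\<close>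

lemma transl_len_ge:
  assumes g: "g \<in> carrier G"
  shows "len g - 2 * gp (act g x) (act (inv g) x) - 2 * \<delta> \<le> transl_len G act x g"
proof -
  define c where "c = len (g [^] (2::nat)) - len g - 2 * \<delta>"
  have "dist (act g x) (act (inv g) x) = len (g [^] (2::nat))"
    using dist_act_inv[OF g, of x "act g x"] g
    by (simp add: act_mult dist_commute numeral_2_eq_2)
  then have c_eq: "c = len g - 2 * gp (act g x) (act (inv g) x) - 2 * \<delta>"
    unfolding c_def using g by (simp add: gromov_product_def field_simps)
  have "c \<le> transl_len G act x g"
  proof (cases "c > 0")
    case True
    have lin: "real k * c \<le> len (g [^] k)" for k
    proof (induction k)
      case (Suc k)
      then show ?case using len_pow_step[OF g c_def True, of k] by (simp add: algebra_simps)
    qed simp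
    show ?thesis
    proof (rule LIMSEQ_le_const[OF transl_len_limit(1)[OF g]], intro exI allI impI)
      fix n :: nat assume "n \<ge> 1"
      then show "c \<le> len (g [^] n) / real n" using lin[of n] by (simp add: field_simps)
    qed
  next
    case False
    then show ?thesis using transl_len_nonneg[OF g] by linarith
  qed
  then show ?thesis using c_eq by simp
qed

section \<open>Loxodromic elements\<close>

lemma len_inv_pow: "f \<in> carrier G \<Longrightarrow> len (inv f [^] (n::nat)) = len (f [^] n)"
  using len_inv[of "f [^] n"] by (simp add: nat_pow_inv)

text \<open>A workable substitute for "the orbit of \<open>x\<close> under powers of
  \<open>f\<close> is a quasi-geodesic". The gain per step has to exceed \<delta> because
  \<open>quasi_axis_additive\<close> excludes an alternative that would force 2c \<le>
  2\<delta>.\<close>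

definition quasi_axis :: "'g \<Rightarrow> real \<Rightarrow> bool" where
  "quasi_axis f c \<longleftrightarrow> f \<in> carrier G \<and> c > \<delta> \<and> (\<forall>k::nat. len (f [^] k) + c \<le> len (f [^] Suc k))"

lemma quasi_axis_inv: "quasi_axis f c \<Longrightarrow> quasi_axis (inv f) c"
  unfolding quasi_axis_def using len_inv_pow[of f] by (metis inv_closed)

lemma quasi_axis_exists:
  assumes g: "g \<in> carrier G" and pos: "transl_len G act x g > 0"
  obtains p c where "p > 0" "quasi_axis (g [^] (p::nat)) c"
proof -
  define t where "t = transl_len G act x g"
  \<comment> \<open>Any factor strictly between 1 and 2 works: since the length of g^(2p) is at
    least 2pt, the gain from g^p to g^(2p) exceeds pt/2, and \<open>M\<close> makes this larger than
    \<open>4 * \<delta> + 1\<close>.\<close>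
  have "\<forall>\<^sub>F n in sequentially. len (g [^] n) / real n < 3 / 2 * t"
    using transl_len_limit(1)[OF g] pos unfolding t_def by (intro order_tendstoD) auto
  then obtain N where N: "\<And>n. n \<ge> N \<Longrightarrow> len (g [^] n) / real n < 3 / 2 * t"
    by (auto simp: eventually_sequentially)
  obtain M :: nat where M: "real M > 2 * (4 * \<delta> + 1) / t" using reals_Archimedean2 by blast
  define p where "p = Suc (max N M)"
  have p: "p > 0" "p \<ge> N" "p \<ge> M" unfolding p_def by auto
  have "len (g [^] p) < real p * (3 / 2 * t)"
    using N[OF p(2)] p(1) by (simp add: field_simps)
  moreover have "real (p + p) * t \<le> len (g [^] (p + p))"
    unfolding t_def by (rule transl_len_limit(2)[OF g])
  moreover have "2 * (4 * \<delta> + 1) < real p * t"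
  proof -
    have "2 * (4 * \<delta> + 1) / t < real p" using M p(3) by linarith
    then show ?thesis using pos unfolding t_def by (simp add: field_simps)
  qed
  ultimately have big: "len (g [^] (p + p)) - len (g [^] p) - 2 * \<delta> > \<delta>"
    using delta_nonneg by (simp add: algebra_simps)
  define f where "f = g [^] p"
  have f: "f \<in> carrier G" "f [^] (2::nat) = g [^] (p + p)"
    unfolding f_def using g by (simp_all add: nat_pow_mult numeral_2_eq_2)
  define c where "c = len (f [^] (2::nat)) - len f - 2 * \<delta>"
  have "c > \<delta>" unfolding c_def f(2) using big f_def by simp
  then have "quasi_axis f c"
    using len_pow_step[OF f(1) c_def] f(1) delta_nonneg unfolding quasi_axis_def by auto
  with p(1) show thesis unfolding f_def by (rule that)
qed

context
  fixes f c assumes qa: "quasi_axis f c"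
begin

lemma quasi_axis_carrier: "f \<in> carrier G"
  using qa unfolding quasi_axis_def by simp

lemma quasi_axis_step: "len (f [^] k) + c \<le> len (f [^] Suc k)"
  using qa unfolding quasi_axis_def by blast

lemma quasi_axis_linear: "real k * c \<le> len (f [^] k)"
proof (induction k)
  case (Suc k)
  then show ?case using quasi_axis_step[of k] by (simp add: algebra_simps del: nat_pow_Suc)
qed simp

text \<open>The triangle inequality along the orbit is sharp up to a constant. In the four-point
  inequality for x, f^m x, f^(m+1) x, f^(m+n) x both lengths on the left gain \<open>c\<close> over
  those in the first alternative, which is thereby excluded.\<close>

lemma quasi_axis_additive:
  "len (f [^] m) + len (f [^] n) - (len f + 2 * \<delta>) \<le> len (f [^] (m + n :: nat))"
proof (cases n)
  case 0
  then show ?thesis using delta_nonneg zero_le_dist[of x "act f x"] by (simp del: zero_le_dist)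
next
  case (Suc k)
  note f = quasi_axis_carrier
  have c: "c > \<delta>" using qa unfolding quasi_axis_def by blast
  have "len (f [^] Suc m) + len (f [^] n)
      \<le> max (len (f [^] m) + len (f [^] k)) (len (f [^] (m + n)) + len f) + 2 * \<delta>"
    using four_point[of x "act (f [^] (m + 1)) x" "act (f [^] m) x" "act (f [^] (m + n)) x"]
      dist_pow[OF f, of m n] dist_pow[OF f, of m 1] dist_pow[OF f, of "m + 1" k] f Suc
    by simp
  then show ?thesis using quasi_axis_step[of m] quasi_axis_step[of k] c delta_nonneg Suc
    by (simp add: max_def del: nat_pow_Suc split: if_splits)
qed

lemma quasi_axis_forward:
  fixes m n :: nat
  shows "real (min m n) * c - (len f + 2 * \<delta>) \<le> gp (act (f [^] m) x) (act (f [^] n) x)"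
proof -
  have *: "real m * c - (len f + 2 * \<delta>) \<le> gp (act (f [^] m) x) (act (f [^] (m + k)) x)" for m k :: nat
    unfolding gromov_product_def
    using quasi_axis_additive[of m k] quasi_axis_linear[of m] dist_pow[OF quasi_axis_carrier, of m k]
      delta_nonneg zero_le_dist[of x "act f x"] by (simp add: field_simps del: zero_le_dist)
  show ?thesis
    using *[of m "n - m"] *[of n "m - n"] by (cases "m \<le> n") (auto simp: gromov_product_commute min_def)
qed

text \<open>Almost additivity for f^(n+m) says that \<open>x\<close> lies almost between f^(-n) x
  and f^m x, so the two ends of the axis stay apart uniformly in the powers.\<close>

lemma quasi_axis_backward:
  fixes m n :: nat
  shows "gp (act (f [^] m) x) (act (inv f [^] n) x) \<le> len f + 2 * \<delta>"
proof -
  note f = quasi_axis_carrier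
  have "dist (act (f [^] m) x) (act (inv f [^] n) x) = len (f [^] (n + m))"
    using dist_act_inv[of "f [^] n" x "act (f [^] m) x"] f
    by (simp add: nat_pow_inv act_mult[symmetric] nat_pow_mult dist_commute)
  moreover have "len (inv f [^] n) = len (f [^] n)"
    using len_inv_pow f by blast
  ultimately show ?thesis
    unfolding gromov_product_def using quasi_axis_additive[of n m]
      delta_nonneg zero_le_dist[of x "act f x"] by (simp add: field_simps del: zero_le_dist)
qed

lemma quasi_axis_conv: "conv_infty x (\<lambda>n::nat. act (f [^] n) x)"
  unfolding conv_infty_def
proof
  fix M
  have c: "c > 0" using qa delta_nonneg unfolding quasi_axis_def by auto
  obtain N :: nat where N: "real N > (M + (len f + 2 * \<delta>)) / c" using reals_Archimedean2 by blast
  show "\<exists>N::nat. \<forall>m\<ge>N. \<forall>n\<ge>N. M \<le> gp (act (f [^] m) x) (act (f [^] n) x)"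
  proof (intro exI allI impI)
    fix m n :: nat assume "N \<le> m" "N \<le> n"
    then have "(M + (len f + 2 * \<delta>)) / c < real (min m n)" using N by auto
    then have "M + (len f + 2 * \<delta>) \<le> real (min m n) * c" using c by (simp add: field_simps)
    then show "M \<le> gp (act (f [^] m) x) (act (f [^] n) x)" using quasi_axis_forward[of m n] by linarith
  qed
qed

end

section \<open>Boundary points of orbits\<close>

lemma bequiv_sym: "bequiv x u v \<Longrightarrow> bequiv x v u"
  unfolding bequiv_def by (metis gromov_product_commute)

lemma bequiv_trans:
  assumes "bequiv x u v" "bequiv x v w"
  shows "bequiv x u w"
  unfolding bequiv_def
proof
  fix M
  obtain N1 where N1: "\<And>m n. m \<ge> N1 \<Longrightarrow> n \<ge> N1 \<Longrightarrow> M + \<delta> \<le> gp (u m) (v n)"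
    using assms(1) unfolding bequiv_def by blast
  obtain N2 where N2: "\<And>m n. m \<ge> N2 \<Longrightarrow> n \<ge> N2 \<Longrightarrow> M + \<delta> \<le> gp (v m) (w n)"
    using assms(2) unfolding bequiv_def by blast
  show "\<exists>N. \<forall>m\<ge>N. \<forall>n\<ge>N. M \<le> gp (u m) (w n)"
  proof (intro exI allI impI)
    fix m n assume "max N1 N2 \<le> m" "max N1 N2 \<le> n"
    then show "M \<le> gp (u m) (w n)"
      using N1[of m "max N1 N2"] N2[of "max N1 N2" n] gp_hyp[of x "u m" "v (max N1 N2)" "w n"] by simp
  qed
qed

lemma bpoint_eq: "bequiv x u v \<Longrightarrow> bpoint x u = bpoint x v"
  unfolding bpoint_def using bequiv_sym bequiv_trans by blast

lemma bequiv_bounded: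
  assumes u: "conv_infty x u" and B: "\<And>n. dist (u n) (v n) \<le> B"
  shows "bequiv x v u"
  unfolding bequiv_def
proof
  fix M
  obtain N where N: "\<And>m n. m \<ge> N \<Longrightarrow> n \<ge> N \<Longrightarrow> M + B \<le> gp (u m) (u n)"
    using u unfolding conv_infty_def by blast
  have "M \<le> gp (v m) (u n)" if "N \<le> m" "N \<le> n" for m n
    using N[OF that] gromov_product_move_point[of x "u m" "u n" "v m"] B[of m] by linarith
  then show "\<exists>N. \<forall>m\<ge>N. \<forall>n\<ge>N. M \<le> gp (v m) (u n)" by blast
qed

text \<open>Non-equivalence only yields arbitrarily late pairs with product below some
  \<open>M\<close>. Late points of one sequence have large mutual products, so hyperbolicity carries
  the bound to all late pairs at the cost of 2\<delta>.\<close>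

lemma not_bequiv_bound:
  assumes u: "conv_infty x u" and v: "conv_infty x v" and neq: "\<not> bequiv x u v"
  obtains \<kappa> N where "\<And>m n. m \<ge> N \<Longrightarrow> n \<ge> N \<Longrightarrow> gp (u m) (v n) \<le> \<kappa>"
proof -
  obtain M where M: "\<And>N. \<exists>m\<ge>N. \<exists>n\<ge>N. gp (u m) (v n) < M"
    using neq unfolding bequiv_def by (meson not_le)
  obtain N1 where N1: "\<And>m n. m \<ge> N1 \<Longrightarrow> n \<ge> N1 \<Longrightarrow> M + 2 * \<delta> \<le> gp (u m) (u n)"
    using u unfolding conv_infty_def by blast
  obtain N2 where N2: "\<And>m n. m \<ge> N2 \<Longrightarrow> n \<ge> N2 \<Longrightarrow> M + 2 * \<delta> \<le> gp (v m) (v n)"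
    using v unfolding conv_infty_def by blast
  show thesis
  proof
    fix m n assume mn: "max N1 N2 \<le> m" "max N1 N2 \<le> n"
    obtain m' n' where *: "m' \<ge> max N1 N2" "n' \<ge> max N1 N2" "gp (u m') (v n') < M" using M by blast
    show "gp (u m) (v n) \<le> M + 2 * \<delta>"
      using gp_hyp2[of "u m'" "u m" "v n" "v n'"] N1[of m' m] N2[of n n'] mn * delta_nonneg
      by (auto simp: min_def split: if_splits)
  qed
qed

lemma boundary_fixpointsI:
  assumes "conv_infty x u" and "\<And>n. dist (u n) (act g (u n)) \<le> B"
  shows "bpoint x u \<in> boundary_fixpoints x (act g)"
proof -
  have "bequiv x (act g \<circ> u) u" using assms by (intro bequiv_bounded) auto
  then show ?thesis unfolding boundary_fixpoints_def using assms(1) bpoint_eq by blast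
qed

text \<open>Powers of \<open>g\<close> commute with \<open>g\<close>, so \<open>g\<close> displaces
  each point of such an orbit by exactly \<open>len g\<close>. Thus disjoint fixed point sets of two
  elements make the orbits of their powers non-equivalent.\<close>

lemma pow_pow_fixpoint:
  assumes g: "g \<in> carrier G" and qa: "quasi_axis (g [^] (p::nat)) c"
  shows "bpoint x (\<lambda>n::nat. act ((g [^] p) [^] n) x) \<in> boundary_fixpoints x (act g)"
    and "bpoint x (\<lambda>n::nat. act (inv (g [^] p) [^] n) x) \<in> boundary_fixpoints x (act g)"
proof -
  have *: "dist (act h x) (act g (act h x)) = len g" if "h \<in> carrier G" "g \<otimes> h = h \<otimes> g" for h
  proof -
    have "act g (act h x) = act h (act g x)" using that g act_mult by metis
    then show ?thesis using that(1) by simp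
  qed
  have comm: "g \<otimes> h [^] n = h [^] n \<otimes> g" if "h \<in> carrier G" "g \<otimes> h = h \<otimes> g" for h and n :: nat
    using group_commutes_pow[of h g n] that g by simp
  have c1: "g \<otimes> g [^] p = g [^] p \<otimes> g" using comm[OF g] by simp
  have c2: "g \<otimes> inv (g [^] p) = inv (g [^] p) \<otimes> g"
  proof -
    have a: "g [^] p \<in> carrier G" using g by simp
    have "inv (g [^] p) \<otimes> g = inv (g [^] p) \<otimes> (g \<otimes> g [^] p) \<otimes> inv (g [^] p)"
      using g a by (simp add: m_assoc)
    also have "\<dots> = g \<otimes> inv (g [^] p)"
      unfolding c1 using g a by (simp flip: m_assoc)
    finally show ?thesis ..
  qed
  show "bpoint x (\<lambda>n::nat. act ((g [^] p) [^] n) x) \<in> boundary_fixpoints x (act g)"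
    by (rule boundary_fixpointsI[OF quasi_axis_conv[OF qa], where B = "len g"])
      (use * comm[OF _ c1] g in auto)
  show "bpoint x (\<lambda>n::nat. act (inv (g [^] p) [^] n) x) \<in> boundary_fixpoints x (act g)"
    by (rule boundary_fixpointsI[OF quasi_axis_conv[OF quasi_axis_inv[OF qa]], where B = "len g"])
      (use * comm[OF _ c2] g in auto)
qed

section \<open>Ping-pong\<close>

text \<open>The product bounds run over all six pairs among the images of \<open>x\<close> under
  \<open>a\<close>, \<open>b\<close> and their inverses. \<open>\<kappa>\<close> and
  \<open>R\<close> are separate because passing to higher powers raises \<open>R\<close> while
  \<open>\<kappa>\<close> stays.\<close>

definition schottky_pair :: "real \<Rightarrow> real \<Rightarrow> 'g \<Rightarrow> 'g \<Rightarrow> bool" where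
  "schottky_pair \<kappa> R a b \<longleftrightarrow> a \<in> carrier G \<and> b \<in> carrier G \<and> R \<le> len a \<and> R \<le> len b \<and>
     gp (act a x) (act (inv a) x) \<le> \<kappa> \<and> gp (act b x) (act (inv b) x) \<le> \<kappa> \<and>
     gp (act a x) (act b x) \<le> \<kappa> \<and> gp (act a x) (act (inv b) x) \<le> \<kappa> \<and>
     gp (act (inv a) x) (act b x) \<le> \<kappa> \<and> gp (act (inv a) x) (act (inv b) x) \<le> \<kappa>"

text \<open>The cross products are bounded since the ends of the two axes are pairwise inequivalent,
  the remaining ones by \<open>quasi_axis_backward\<close>; lengths grow linearly. The exponents
  vary independently so that both powers can later be reached by the walk at the same time.\<close>

lemma schottky_powers:
  assumes g: "g \<in> carrier G" "transl_len G act x g > 0"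
    and h: "h \<in> carrier G" "transl_len G act x h > 0"
    and disj: "boundary_fixpoints x (act g) \<inter> boundary_fixpoints x (act h) = {}"
  obtains \<kappa> and p q :: nat where "p > 0" "q > 0"
    "\<And>R. \<exists>N. \<forall>i\<ge>N. \<forall>j\<ge>N. schottky_pair \<kappa> R (g [^] (p * i)) (h [^] (q * j))"
proof -
  obtain p c where p: "p > 0" "quasi_axis (g [^] (p::nat)) c" using quasi_axis_exists[OF g] .
  obtain q d where q: "q > 0" "quasi_axis (h [^] (q::nat)) d" using quasi_axis_exists[OF h] .
  define a where "a = g [^] p"
  define b where "b = h [^] q"
  have a: "quasi_axis a c" and b: "quasi_axis b d" using p q unfolding a_def b_def by auto
  note ab = quasi_axis_carrier[OF a] quasi_axis_carrier[OF b]
  have bnd: "\<exists>\<kappa> (N::nat). \<forall>m\<ge>N. \<forall>n\<ge>N. gp (act (a' [^] m) x) (act (b' [^] n) x) \<le> \<kappa>"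
    if a': "a' \<in> {a, inv a}" and b': "b' \<in> {b, inv b}" for a' b'
  proof -
    have qa: "quasi_axis a' c" "quasi_axis b' d" using a' b' a b quasi_axis_inv by auto
    have "bpoint x (\<lambda>n::nat. act (a' [^] n) x) \<in> boundary_fixpoints x (act g)"
      using a' pow_pow_fixpoint[OF g(1) p(2)] unfolding a_def by auto
    moreover have "bpoint x (\<lambda>n::nat. act (b' [^] n) x) \<in> boundary_fixpoints x (act h)"
      using b' pow_pow_fixpoint[OF h(1) q(2)] unfolding b_def by auto
    ultimately have "\<not> bequiv x (\<lambda>n::nat. act (a' [^] n) x) (\<lambda>n::nat. act (b' [^] n) x)"
      using bpoint_eq disj by fastforce
    then obtain \<kappa> N where
      "\<And>m n::nat. m \<ge> N \<Longrightarrow> n \<ge> N \<Longrightarrow> gp (act (a' [^] m) x) (act (b' [^] n) x) \<le> \<kappa>"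
      by (rule not_bequiv_bound[OF quasi_axis_conv[OF qa(1)] quasi_axis_conv[OF qa(2)]]) blast
    then show ?thesis by blast
  qed
  obtain k1 N1 where k1:
    "\<And>m n::nat. m \<ge> N1 \<Longrightarrow> n \<ge> N1 \<Longrightarrow> gp (act (a [^] m) x) (act (b [^] n) x) \<le> k1"
    using bnd[of "a" "b"] by blast
  obtain k2 N2 where k2:
    "\<And>m n::nat. m \<ge> N2 \<Longrightarrow> n \<ge> N2 \<Longrightarrow> gp (act (a [^] m) x) (act (inv b [^] n) x) \<le> k2"
    using bnd[of "a" "inv b"] by blast
  obtain k3 N3 where k3:
    "\<And>m n::nat. m \<ge> N3 \<Longrightarrow> n \<ge> N3 \<Longrightarrow> gp (act (inv a [^] m) x) (act (b [^] n) x) \<le> k3"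
    using bnd[of "inv a" "b"] by blast
  obtain k4 N4 where k4:
    "\<And>m n::nat. m \<ge> N4 \<Longrightarrow> n \<ge> N4 \<Longrightarrow> gp (act (inv a [^] m) x) (act (inv b [^] n) x) \<le> k4"
    using bnd[of "inv a" "inv b"] by blast
  define \<kappa> where "\<kappa> = Max {k1, k2, k3, k4, len a + 2 * \<delta>, len b + 2 * \<delta>}"
  have \<kappa>: "k1 \<le> \<kappa>" "k2 \<le> \<kappa>" "k3 \<le> \<kappa>" "k4 \<le> \<kappa>" "len a + 2 * \<delta> \<le> \<kappa>" "len b + 2 * \<delta> \<le> \<kappa>"
    unfolding \<kappa>_def by (intro Max_ge; simp)+
  have cd: "c > 0" "d > 0" using a b delta_nonneg unfolding quasi_axis_def by auto
  show thesis
  proof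
    show "p > 0" "q > 0" using p q by auto
    fix R
    obtain M :: nat where M: "real M > max (R / c) (R / d)" using reals_Archimedean2 by blast
    define N where "N = Max {M, N1, N2, N3, N4}"
    have N: "M \<le> N" "N1 \<le> N" "N2 \<le> N" "N3 \<le> N" "N4 \<le> N" unfolding N_def by (intro Max_ge; simp)+
    show "\<exists>N. \<forall>i\<ge>N. \<forall>j\<ge>N. schottky_pair \<kappa> R (g [^] (p * i)) (h [^] (q * j))"
    proof (intro exI allI impI)
      fix i j assume ij: "i \<ge> N" "j \<ge> N"
      have eq: "g [^] (p * i) = a [^] i" "h [^] (q * j) = b [^] j"
        unfolding a_def b_def using g h by (simp_all add: nat_pow_pow)
      have "R / c < real i" "R / d < real j" using M N ij by linarith+
      then have "R < real i * c" "R < real j * d" using cd by (simp_all add: field_simps)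
      then have R: "R \<le> len (a [^] i)" "R \<le> len (b [^] j)"
        using quasi_axis_linear[OF a, of i] quasi_axis_linear[OF b, of j] by auto
      show "schottky_pair \<kappa> R (g [^] (p * i)) (h [^] (q * j))"
        unfolding schottky_pair_def eq
        using ab R quasi_axis_backward[OF a, of i i] quasi_axis_backward[OF b, of j j]
          k1[of i j] k2[of i j] k3[of i j] k4[of i j] N ij \<kappa> by (simp add: nat_pow_inv)
    qed
  qed
qed

end

section \<open>Random walks and the maximum principle\<close>

lemma integrable_pmf_bounded:
  fixes f :: "'c \<Rightarrow> real"
  assumes "\<And>a. a \<in> set_pmf p \<Longrightarrow> \<bar>f a\<bar> \<le> B"
  shows "integrable (measure_pmf p) f"
  by (rule measure_pmf.integrable_const_bound[where B = B]) (use assms in \<open>auto simp: AE_measure_pmf_iff\<close>)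

lemma expectation_mono:
  fixes f h :: "'c \<Rightarrow> real"
  assumes "\<And>a. a \<in> set_pmf p \<Longrightarrow> \<bar>f a\<bar> \<le> B" "\<And>a. a \<in> set_pmf p \<Longrightarrow> \<bar>h a\<bar> \<le> C"
    and "\<And>a. a \<in> set_pmf p \<Longrightarrow> f a \<le> h a"
  shows "measure_pmf.expectation p f \<le> measure_pmf.expectation p h"
  by (intro integral_mono_AE integrable_pmf_bounded assms) (use assms in \<open>auto simp: AE_measure_pmf_iff\<close>)

lemma expectation_le_const:
  fixes f :: "'c \<Rightarrow> real"
  assumes "\<And>a. a \<in> set_pmf p \<Longrightarrow> \<bar>f a\<bar> \<le> B" "\<And>a. a \<in> set_pmf p \<Longrightarrow> f a \<le> c"
  shows "measure_pmf.expectation p f \<le> c"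
  using expectation_mono[of p f B "\<lambda>_. c" "\<bar>c\<bar>"] assms by simp

lemma expectation_ge_const:
  fixes f :: "'c \<Rightarrow> real"
  assumes "\<And>a. a \<in> set_pmf p \<Longrightarrow> \<bar>f a\<bar> \<le> B" "\<And>a. a \<in> set_pmf p \<Longrightarrow> c \<le> f a"
  shows "c \<le> measure_pmf.expectation p f"
  using expectation_mono[of p "\<lambda>_. c" "\<bar>c\<bar>" f B] assms by simp

lemma expectation_abs_le:
  fixes f :: "'c \<Rightarrow> real"
  assumes "\<And>a. a \<in> set_pmf p \<Longrightarrow> \<bar>f a\<bar> \<le> B"
  shows "\<bar>measure_pmf.expectation p f\<bar> \<le> B"
  using expectation_le_const[of p f B B] expectation_ge_const[of p f B "- B"] assms
  by (meson abs_le_iff minus_le_iff)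

text \<open>The tower rule, reduced to the nonnegative integral by adding the constant
  \<open>B\<close>.\<close>

lemma expectation_bind:
  fixes f :: "'d \<Rightarrow> real"
  assumes B: "\<And>b. b \<in> set_pmf (bind_pmf p N) \<Longrightarrow> \<bar>f b\<bar> \<le> B"
  shows "measure_pmf.expectation (bind_pmf p N) f
    = measure_pmf.expectation p (\<lambda>a. measure_pmf.expectation (N a) f)"
proof -
  have BN: "\<bar>f b\<bar> \<le> B" if "a \<in> set_pmf p" "b \<in> set_pmf (N a)" for a b
    using B that by auto
  have nn: "ennreal (measure_pmf.expectation q (\<lambda>b. f b + B)) = (\<integral>\<^sup>+b. ennreal (f b + B) \<partial>measure_pmf q)"
    if "\<And>b. b \<in> set_pmf q \<Longrightarrow> \<bar>f b\<bar> \<le> B" for q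
  proof (rule nn_integral_eq_integral[symmetric])
    show "integrable (measure_pmf q) (\<lambda>b. f b + B)"
      using that by (intro integrable_pmf_bounded[where B = "B + \<bar>B\<bar>"]) force
    show "AE b in measure_pmf q. 0 \<le> f b + B"
      using that by (force simp: AE_measure_pmf_iff)
  qed
  have shift: "measure_pmf.expectation q (\<lambda>b. f b + B) = measure_pmf.expectation q f + B"
    if "\<And>b. b \<in> set_pmf q \<Longrightarrow> \<bar>f b\<bar> \<le> B" for q
    using integrable_pmf_bounded[of q f B] that by simp
  have ge: "0 \<le> measure_pmf.expectation q f + B" if "\<And>b. b \<in> set_pmf q \<Longrightarrow> \<bar>f b\<bar> \<le> B" for q
    using expectation_abs_le[of q f B] that by force
  let ?E = "\<lambda>a. measure_pmf.expectation (N a) f"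
  have E: "\<bar>?E a\<bar> \<le> B" if "a \<in> set_pmf p" for a
    using BN[OF that] by (intro expectation_abs_le)
  have "ennreal (measure_pmf.expectation (bind_pmf p N) f + B)
      = (\<integral>\<^sup>+a. \<integral>\<^sup>+b. ennreal (f b + B) \<partial>measure_pmf (N a) \<partial>measure_pmf p)"
    using nn[of "bind_pmf p N", OF B] shift[of "bind_pmf p N", OF B] by simp
  also have "\<dots> = (\<integral>\<^sup>+a. ennreal (?E a + B) \<partial>measure_pmf p)"
    by (intro nn_integral_cong_AE AE_pmfI) (metis nn shift BN)
  also have "\<dots> = ennreal (measure_pmf.expectation p (\<lambda>a. ?E a + B))"
  proof (rule nn_integral_eq_integral)
    show "integrable (measure_pmf p) (\<lambda>a. ?E a + B)"
      using E by (intro integrable_pmf_bounded[where B = "B + \<bar>B\<bar>"]) force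
    show "AE a in measure_pmf p. 0 \<le> ?E a + B"
      using E by (force simp: AE_measure_pmf_iff)
  qed
  also have "measure_pmf.expectation p (\<lambda>a. ?E a + B) = measure_pmf.expectation p ?E + B"
    using integrable_pmf_bounded[of p ?E B] E by simp
  finally show ?thesis
    using ge[of "bind_pmf p N", OF B] expectation_abs_le[of p ?E B] E by (subst (asm) ennreal_inj) auto
qed

lemma finite_words: "finite {w :: bool list. length w = k \<and> P w}"
  by (rule finite_subset[OF _ finite_lists_length_eq[of "UNIV :: bool set" k]]) auto

text \<open>Words are lists of truth values, so there are exactly 2^k of length k, whatever elements
  they spell.\<close>

definition pick :: "'c \<Rightarrow> 'c \<Rightarrow> bool \<Rightarrow> 'c" where
  "pick a b t = (if t then a else b)"

section \<open>Counting words in a Schottky pair\<close>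

context hyperbolic_action
begin

context
  fixes a b :: 'g and \<kappa> r R \<rho> :: real
  assumes pair: "schottky_pair \<kappa> R a b"
    \<comment> \<open>The margin 2\<delta> + 1 of \<open>\<rho>\<close> over \<open>\<kappa>\<close>
      pays for two uses of hyperbolicity in \<open>repel_near_unique\<close>. The value of
      \<open>R\<close> gives \<open>len (letter t) - \<rho> \<ge> \<rho> + r\<close>, so a repelling
      region survives a move by \<open>r\<close>.\<close>
    and r: "0 \<le> r" and \<rho>: "\<rho> = \<kappa> + 2 * \<delta> + 1" and R: "R = 2 * \<rho> + r"
begin

abbreviation letter :: "bool \<Rightarrow> 'g" where "letter \<equiv> pick a b"

abbreviation near :: "real \<Rightarrow> 'a \<Rightarrow> 'a \<Rightarrow> bool" where
  "near C u z \<equiv> dist u z \<le> r \<or> C < gp u z"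

text \<open>\<open>fold\<close> undoes the first letter first, so this is the action of the inverse
  of the whole word.\<close>

abbreviation undo :: "bool list \<Rightarrow> 'a \<Rightarrow> 'a" where
  "undo \<equiv> fold (\<lambda>t. act (inv letter t))"

text \<open>Undoing a letter from outside its attracting region leads into its repelling region, which is
  outside both attracting regions. So once the undone word deviates from the itinerary of \<open>y\<close>, all its
  remaining letters can be read off, last letter first, from any point near the end point.\<close>

definition attr :: "bool \<Rightarrow> 'a \<Rightarrow> bool" where
  "attr t u \<longleftrightarrow> \<rho> < gp u (act (letter t) x)"

text \<open>The threshold is the one that \<open>gp_complement_inv\<close> produces outside the
  attracting region of the same letter.\<close>

definition repel :: "bool \<Rightarrow> 'a \<Rightarrow> bool" where
  "repel t u \<longleftrightarrow> len (letter t) - \<rho> \<le> gp u (act (inv letter t) x)"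

lemma letter_carrier: "letter t \<in> carrier G"
  using pair unfolding schottky_pair_def pick_def by simp

lemma \<kappa>_nonneg: "0 \<le> \<kappa>"
  using pair gromov_product_nonneg[of x "act a x" "act b x"] unfolding schottky_pair_def by linarith

lemma letter_len: "R \<le> len (letter t)"
  using pair unfolding schottky_pair_def pick_def by simp

lemma letter_gp:
  "gp (act (letter s) x) (act (inv letter t) x) \<le> \<kappa>"
  "s \<noteq> t \<Longrightarrow> gp (act (letter s) x) (act (letter t) x) \<le> \<kappa>"
  "s \<noteq> t \<Longrightarrow> gp (act (inv letter s) x) (act (inv letter t) x) \<le> \<kappa>"
  using pair unfolding schottky_pair_def pick_def by (auto simp: gromov_product_commute)

lemma repel_undo: "\<not> attr t u \<Longrightarrow> repel t (act (inv letter t) u)"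
  unfolding attr_def repel_def using gp_complement_inv[OF letter_carrier, of t u] by linarith

text \<open>A common point would give the two defining directions a product of at least
  \<open>\<rho> - \<delta>\<close>, which exceeds \<open>\<kappa>\<close>.\<close>

lemma repel_not_attr: "repel s u \<Longrightarrow> \<not> attr t u"
  unfolding attr_def repel_def
  using letter_gp(1)[of t s] letter_len[of s] gp_hyp[of x "act (letter t) x" u "act (inv letter s) x"]
    \<rho> R r \<kappa>_nonneg delta_nonneg gromov_product_commute[of x u]
  by (auto simp: min_def split: if_splits)

lemma attr_unique: "attr s u \<Longrightarrow> attr t u \<Longrightarrow> s = t"
  unfolding attr_def
  using letter_gp(2)[of s t] gp_hyp[of x "act (letter s) x" u "act (letter t) x"]
    \<rho> \<kappa>_nonneg delta_nonneg gromov_product_commute[of x u]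
  by (cases "s = t") (auto simp: min_def split: if_splits)

text \<open>Even a point merely near \<open>u\<close> still shows the direction of the letter undone
  last: closeness costs at most \<open>r\<close>, and a common direction costs \<delta>.\<close>

lemma repel_near:
  assumes "repel t u" "near C u z" "\<rho> \<le> C"
  shows "\<rho> - \<delta> \<le> gp (act (inv letter t) x) z"
  using assms(2)
proof
  assume "dist u z \<le> r"
  then show ?thesis
    using assms(1) gromov_product_move_point[of x u "act (inv letter t) x" z] letter_len[of t] R delta_nonneg
      gromov_product_commute[of x z] unfolding repel_def by (smt (verit))
next
  assume "C < gp u z"
  then show ?thesis
    using assms(1,3) gp_hyp[of x "act (inv letter t) x" u z] letter_len[of t] R r \<rho> \<kappa>_nonneg delta_nonneg
      gromov_product_commute[of x u "act (inv letter t) x"] unfolding repel_def by (smt (verit))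
qed

lemma repel_near_unique:
  assumes "repel s u" "near C u z" "repel t v" "near C v z" "\<rho> \<le> C"
  shows "s = t"
proof (rule ccontr)
  assume "s \<noteq> t"
  then show False
    using letter_gp(3)[of s t] repel_near[OF assms(1,2,5)] repel_near[OF assms(3,4,5)] \<rho>
      gp_hyp[of x "act (inv letter s) x" z "act (inv letter t) x"]
      gromov_product_commute[of x z "act (inv letter t) x"] by (smt (verit))
qed

lemma near_act:
  assumes "near C (act (inv g) u) z" "g \<in> carrier G" "len g \<le> \<Delta>"
  shows "near (C - \<Delta>) u (act g z)"
proof -
  have "gp (act (inv g) u) z \<le> gp u (act g z) + \<Delta>"
    using gp_act_inv_le[OF assms(2), of u z] assms(3) by linarith
  then show ?thesis using assms dist_act_inv[of g u z] by auto
qed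

lemma undo_not_attr: "(\<And>t. \<not> attr t y) \<Longrightarrow> \<not> attr s (undo w y)"
proof (induction w arbitrary: y)
  case (Cons t w)
  have "\<And>s. \<not> attr s (act (inv letter t) y)" using Cons.prems repel_undo repel_not_attr by blast
  then show ?case using Cons.IH by simp
qed simp

text \<open>The two last letters agree by \<open>repel_near_unique\<close>. Putting that letter back
  on \<open>z\<close> lowers the threshold by at most \<open>\<Delta>\<close>, so a budget of
  \<open>\<Delta>\<close> per letter suffices.\<close>

lemma undo_unique:
  assumes "\<And>t. \<not> attr t y" "length w = length v" "near C (undo w y) z" "near C (undo v y) z"
    and "\<rho> + real (length w) * \<Delta> \<le> C" "len a \<le> \<Delta>" "len b \<le> \<Delta>"
  shows "w = v"
  using assms(2-5)
proof (induction w arbitrary: v z C rule: rev_induct)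
  case (snoc s w)
  from snoc.prems(1) obtain v' t where v: "v = v' @ [t]" "length v' = length w"
    by (cases v rule: rev_cases) auto
  have \<Delta>: "0 \<le> \<Delta>" using assms(6) zero_le_dist[of x "act a x"] by linarith
  have C: "\<rho> \<le> C" using snoc.prems(4) \<Delta> by (smt (verit) mult_nonneg_nonneg of_nat_0_le_iff)
  have "repel s (undo (w @ [s]) y)" "repel t (undo (v' @ [t]) y)"
    using repel_undo undo_not_attr[OF assms(1)] by simp_all
  then have st: "s = t"
    using repel_near_unique[of s "undo (w @ [s]) y" z C t "undo (v' @ [t]) y"] snoc.prems(2,3) C v by simp
  have ls: "len (letter s) \<le> \<Delta>" using assms(6,7) unfolding pick_def by simp
  have "near (C - \<Delta>) (undo w y) (act (letter s) z)"
    using near_act[where C = C and u = "undo w y", OF _ letter_carrier ls] snoc.prems(2) by simp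
  moreover have "near (C - \<Delta>) (undo v' y) (act (letter s) z)"
    using near_act[where C = C and u = "undo v' y", OF _ letter_carrier ls] snoc.prems(3) v st by simp
  moreover have "\<rho> + real (length w) * \<Delta> \<le> C - \<Delta>"
    using snoc.prems(4) by (simp add: algebra_simps)
  ultimately have "w = v'" using snoc.IH[of v'] v by metis
  then show ?case using v st by simp
qed simp

text \<open>By \<open>attr_unique\<close>, \<open>y\<close> is outside the attracting region of some
  letter \<open>t\<close>. After undoing \<open>t\<close> no attracting region is met again, and at
  most one word remains; words starting with the other letter are counted by induction. Each
  position thus adds at most one word.\<close>

lemma schottky_count:
  assumes \<Delta>: "len a \<le> \<Delta>" "len b \<le> \<Delta>" and C: "\<rho> + real k * \<Delta> \<le> C"
  shows "card {w. length w = k \<and> near C (undo w y) z} \<le> k + 1"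
  using C
proof (induction k arbitrary: y)
  case 0
  have "{w. length w = 0 \<and> near C (undo w y) z} \<subseteq> {[]}" by auto
  then have "card {w. length w = 0 \<and> near C (undo w y) z} \<le> card {[] :: bool list}"
    by (rule card_mono[rotated]) simp
  then show ?case by (simp only: card.insert[OF finite.emptyI] empty_iff not_False_eq_True card.empty)
next
  case (Suc k)
  have \<Delta>0: "0 \<le> \<Delta>" using \<Delta>(1) zero_le_dist[of x "act a x"] by linarith
  have C': "\<rho> + real k * \<Delta> \<le> C" using Suc.prems \<Delta>0 by (simp add: algebra_simps)
  define S where "S t = {w. length w = k \<and> near C (undo w (act (inv letter t) y)) z}" for t
  have fin: "finite (S t)" for t unfolding S_def by (rule finite_words)
  have "{w. length w = Suc k \<and> near C (undo w y) z} \<subseteq> (\<Union>t. (#) t ` S t)"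
  proof
    fix w assume w: "w \<in> {w. length w = Suc k \<and> near C (undo w y) z}"
    then obtain t v where "w = t # v" by (cases w) auto
    with w have "v \<in> S t" unfolding S_def by simp
    with \<open>w = t # v\<close> show "w \<in> (\<Union>t. (#) t ` S t)" by blast
  qed
  then have le: "card {w. length w = Suc k \<and> near C (undo w y) z} \<le> card (\<Union>t. (#) t ` S t)"
    using fin by (intro card_mono) auto
  obtain t where t: "\<not> attr t y" using attr_unique[of True y False] by blast
  have "\<And>s. \<not> attr s (act (inv letter t) y)" using repel_undo[OF t] repel_not_attr by blast
  then have "w = v" if "w \<in> S t" "v \<in> S t" for w v
    using that undo_unique[of "act (inv letter t) y" w v z C \<Delta>] C' \<Delta> unfolding S_def by auto
  then have St: "card (S t) \<le> 1" using fin[of t] by (simp add: card_le_Suc0_iff_eq)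
  have Snt: "card (S (\<not> t)) \<le> k + 1" unfolding S_def by (rule Suc.IH[OF C'])
  have "(\<Union>t. (#) t ` S t) = (#) t ` S t \<union> (#) (\<not> t) ` S (\<not> t)"
    by (cases t) (auto simp: UNIV_bool)
  then have "card (\<Union>t. (#) t ` S t) = card ((#) t ` S t \<union> (#) (\<not> t) ` S (\<not> t))" by simp
  then have "card (\<Union>t. (#) t ` S t) \<le> card (S t) + card (S (\<not> t))"
    using card_Un_le[of "(#) t ` S t" "(#) (\<not> t) ` S (\<not> t)"] card_image_le[OF fin[of t], of "(#) t"]
      card_image_le[OF fin[of "\<not> t"], of "(#) (\<not> t)"] by linarith
  then show ?case using le St Snt by linarith
qed

end

section \<open>The law of the walk at a fixed time\<close>

definition walk :: "'g pmf \<Rightarrow> nat \<Rightarrow> 'g pmf" where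
  "walk \<nu> n = map_pmf (gprod G) (replicate_pmf n \<nu>)"

lemma gprod_Nil [simp]: "gprod G [] = \<one>"
  by (simp add: gprod_def)

lemma gprod_Cons [simp]: "gprod G (g # l) = g \<otimes> gprod G l"
  by (simp add: gprod_def)

lemma gprod_closed [simp]: "set l \<subseteq> carrier G \<Longrightarrow> gprod G l \<in> carrier G"
  by (induction l) auto

lemma gprod_append:
  "set k \<subseteq> carrier G \<Longrightarrow> set l \<subseteq> carrier G \<Longrightarrow> gprod G (k @ l) = gprod G k \<otimes> gprod G l"
  by (induction k) (auto simp: m_assoc)

lemma len_gprod_le:
  assumes "set l \<subseteq> carrier G" "\<And>g. g \<in> set l \<Longrightarrow> len g \<le> D"
  shows "len (gprod G l) \<le> real (length l) * D"
  using assms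
proof (induction l)
  case (Cons g l)
  then show ?case using len_mult[of g "gprod G l"] by (fastforce simp: algebra_simps)
qed simp

lemma walk_0 [simp]: "walk \<nu> 0 = return_pmf \<one>"
  by (simp add: walk_def)

lemma walk_Suc: "walk \<nu> (Suc n) = bind_pmf \<nu> (\<lambda>g. map_pmf (\<lambda>h. g \<otimes> h) (walk \<nu> n))"
  by (simp add: walk_def map_bind_pmf map_pmf_comp bind_return_pmf' flip: map_pmf_def)

end

lemma prob_bind:
  "measure_pmf.prob (bind_pmf p N) A = measure_pmf.expectation p (\<lambda>a. measure_pmf.prob (N a) A)"
  using expectation_bind[of p N "indicator A" 1] by (simp add: indicator_def)

locale hyperbolic_walk = hyperbolic_action G act x \<delta>
  for G :: "('g, 'b) monoid_scheme" (structure)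
    and act :: "'g \<Rightarrow> 'a::metric_space \<Rightarrow> 'a" and x :: 'a and \<delta> :: real +
  fixes \<nu> :: "'g pmf" and D :: real
  assumes supp: "set_pmf \<nu> \<subseteq> carrier G"
    and step_le: "\<And>g. g \<in> set_pmf \<nu> \<Longrightarrow> len g \<le> D"
begin

abbreviation W :: "nat \<Rightarrow> 'g pmf" where "W \<equiv> walk \<nu>"

lemma D_nonneg: "0 \<le> D"
proof -
  obtain g where "g \<in> set_pmf \<nu>" using set_pmf_not_empty[of \<nu>] by blast
  then show ?thesis using step_le[of g] zero_le_dist[of x "act g x"] by linarith
qed

lemma walk_closed: "w \<in> set_pmf (W n) \<Longrightarrow> w \<in> carrier G"
  using supp by (auto simp: walk_def set_replicate_pmf intro!: gprod_closed)

lemma walk_len: "w \<in> set_pmf (W n) \<Longrightarrow> len w \<le> real n * D"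
  using supp step_le by (auto simp: walk_def set_replicate_pmf intro!: len_gprod_le)

lemma walk_add: "W (m + n) = bind_pmf (W m) (\<lambda>a. map_pmf (\<lambda>b. a \<otimes> b) (W n))"
proof -
  have "W (m + n) = bind_pmf (replicate_pmf m \<nu>)
      (\<lambda>k. bind_pmf (replicate_pmf n \<nu>) (\<lambda>l. return_pmf (gprod G (k @ l))))"
    by (simp add: walk_def replicate_pmf_distrib map_bind_pmf)
  also have "\<dots> = bind_pmf (replicate_pmf m \<nu>)
      (\<lambda>k. bind_pmf (replicate_pmf n \<nu>) (\<lambda>l. return_pmf (gprod G k \<otimes> gprod G l)))"
    using supp by (intro bind_pmf_cong refl)
      (auto simp: set_replicate_pmf intro!: arg_cong[where f = return_pmf] gprod_append)
  also have "\<dots> = bind_pmf (W m) (\<lambda>a. map_pmf (\<lambda>b. a \<otimes> b) (W n))"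
    by (simp add: walk_def bind_map_pmf map_pmf_comp) (simp add: map_pmf_def)
  finally show ?thesis .
qed

lemma walk_walk: "walk (W N) n = W (n * N)"
proof (induction n)
  case (Suc n)
  then show ?case by (simp add: walk_Suc walk_add)
qed simp

text \<open>Grouping \<open>N\<close> steps into one gives a walk of the same kind; this places a
  Schottky pair in the support of a single step.\<close>

lemma hyperbolic_walk_walk: "hyperbolic_walk G act x \<delta> (W N) (real N * D)"
  by unfold_locales (use walk_closed walk_len in auto)

lemma pow_in_walk: "g \<in> set_pmf (W n) \<Longrightarrow> g [^] (m::nat) \<in> set_pmf (W (m * n))"
proof (induction m)
  case (Suc m)
  then have "g [^] m \<otimes> g \<in> set_pmf (W (m * n + n))" unfolding walk_add by auto
  then show ?case by (simp add: add.commute)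
qed simp

lemma gen_semigroup_in_walk:
  assumes "g \<in> gen_semigroup G (set_pmf \<nu>)"
  obtains n where "n > 0" "g \<in> set_pmf (W n)"
proof -
  from assms obtain l where "g = gprod G l" "l \<noteq> []" "set l \<subseteq> set_pmf \<nu>"
    unfolding gen_semigroup_def by blast
  then show thesis by (intro that[of "length l"]) (auto simp: walk_def set_replicate_pmf)
qed

lemma act_inv_mult:
  "g \<in> carrier G \<Longrightarrow> h \<in> carrier G \<Longrightarrow> act (inv (g \<otimes> h)) y = act (inv h) (act (inv g) y)"
  by (simp add: inv_mult_group act_mult)

text \<open>The inverse of a product undoes its first factor first, so conditioning on the first
  step only moves the starting point.\<close>

lemma prob_walk_Suc:
  "measure_pmf.prob (W (Suc n)) {w. P (act (inv w) y)}
    = measure_pmf.expectation \<nu> (\<lambda>g. measure_pmf.prob (W n) {w. P (act (inv w) (act (inv g) y))})"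
  unfolding walk_Suc prob_bind
proof (intro integral_cong_AE)
  show "AE g in measure_pmf \<nu>.
      measure_pmf.prob (map_pmf ((\<otimes>) g) (W n)) {w. P (act (inv w) y)} =
      measure_pmf.prob (W n) {w. P (act (inv w) (act (inv g) y))}"
  proof (rule AE_pmfI)
    fix g assume "g \<in> set_pmf \<nu>"
    then have g: "g \<in> carrier G" using supp by blast
    show "measure_pmf.prob (map_pmf ((\<otimes>) g) (W n)) {w. P (act (inv w) y)} =
      measure_pmf.prob (W n) {w. P (act (inv w) (act (inv g) y))}"
      unfolding measure_map_pmf
      by (rule measure_pmf.finite_measure_eq_AE)
        (use g walk_closed in \<open>auto simp: AE_measure_pmf_iff act_inv_mult\<close>)
  qed
qed auto

text \<open>As \<open>n\<close> grows, the supremum \<open>Q n\<close> over \<open>y, z\<close> of the probabilities below decreases. If \<open>n\<close> is so large that \<open>Q n\<close>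
  is almost minimal, a starting point that is almost optimal for \<open>n + k\<close> steps stays almost optimal for
  \<open>n\<close> steps after undoing any word of length \<open>k\<close> in \<open>a\<close> and \<open>b\<close>; these \<open>2\<^sup>k\<close> events have multiplicity at
  most \<open>j\<close>.\<close>

lemma concentration_bound:
  fixes T :: "nat \<Rightarrow> 'a \<Rightarrow> 'a \<Rightarrow> bool" and R :: "'a \<Rightarrow> 'a \<Rightarrow> bool"
  assumes ab: "a \<in> set_pmf \<nu>" "b \<in> set_pmf \<nu>"
    and antimono: "\<And>n u z. T (Suc n) u z \<Longrightarrow> T n u z"
    and near: "\<And>n w u z. w \<in> set_pmf (W n) \<Longrightarrow> T (n + k) (act (inv w) u) z \<Longrightarrow> R u (act w z)"
    and count: "\<And>y z. card {w. length w = k \<and> R (fold (\<lambda>t. act (inv (pick a b t))) w y) z} \<le> j"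
    and \<epsilon>: "0 < \<epsilon>"
  obtains n where "\<And>y z. measure_pmf.prob (W n) {w. T n (act (inv w) y) z} \<le> real j / 2 ^ k + \<epsilon>"
proof -
  \<comment> \<open>The number of steps and the index of \<open>T\<close> are separate: in the
    descent below the index stays at \<open>m\<close> while steps are removed.\<close>
  define P where "P n m y z = measure_pmf.prob (W n) {w. T m (act (inv w) y) z}" for n m y z
  define Q where "Q n = (SUP (y, z). P n n y z)" for n
  have P01: "0 \<le> P n m y z" "P n m y z \<le> 1" for n m y z unfolding P_def by auto
  have T_le: "T m u z" if "T n u z" "m \<le> n" for n m u z
    using that(2,1) by (induction rule: inc_induct) (auto intro: antimono)
  have bdd: "bdd_above (range (\<lambda>(y, z). P n n y z))" for n
    by (rule bdd_aboveI[of _ 1]) (use P01 in auto)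
  have PQ: "P n m y z \<le> Q n" if "n \<le> m" for n m y z
  proof -
    have "P n m y z \<le> P n n y z"
      unfolding P_def by (rule measure_pmf.finite_measure_mono) (use T_le that in auto)
    also have "\<dots> \<le> Q n"
      unfolding Q_def using cSUP_upper[OF _ bdd, of "(y, z)" n] by simp
    finally show ?thesis .
  qed
  have rec: "P (Suc n) m y z = measure_pmf.expectation \<nu> (\<lambda>g. P n m (act (inv g) y) z)" for n m y z
    unfolding P_def by (rule prob_walk_Suc)
  have Q_Suc: "Q (Suc n) \<le> Q n" for n
    unfolding Q_def[of "Suc n"]
  proof (rule cSUP_least)
    fix yz :: "'a \<times> 'a"
    obtain y z where yz: "yz = (y, z)" by (cases yz)
    have "P (Suc n) (Suc n) y z \<le> Q n"
      unfolding rec by (rule expectation_le_const[where B = 1]) (use P01 PQ in auto)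
    then show "(case yz of (y, z) \<Rightarrow> P (Suc n) (Suc n) y z) \<le> Q n" using yz by simp
  qed simp
  have dec: "decseq Q" by (rule decseq_SucI) (rule Q_Suc)
  have Q0: "0 \<le> Q n" for n using PQ[of n n] P01(1) by (meson order.refl order.trans)
  obtain L where L: "Q \<longlonglongrightarrow> L" "\<And>n. L \<le> Q n"
    using decseq_convergent[OF dec, of 0] Q0 by blast
  define \<alpha> where "\<alpha> = min (pmf \<nu> a) (pmf \<nu> b)"
  have \<alpha>: "0 < \<alpha>" "\<alpha> \<le> 1" unfolding \<alpha>_def using ab by (auto simp: pmf_positive pmf_le_1 min_le_iff_disj)
  \<comment> \<open>\<open>\<beta>\<close> is the factor by which the deficit below \<open>L\<close>
    may grow per undone letter; \<open>\<eta>\<close> is chosen so that after \<open>k\<close>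
    letters the deficit is still \<open>\<epsilon> / 2\<close>.\<close>
  define \<beta> where "\<beta> = 2 / \<alpha>"
  have \<beta>: "1 \<le> \<beta>" unfolding \<beta>_def using \<alpha> by (simp add: field_simps)
  define \<eta> where "\<eta> = \<epsilon> / (2 * \<beta> ^ k)"
  have \<beta>k: "1 \<le> \<beta> ^ k" using \<beta> by simp
  have \<eta>: "0 < \<eta>" "\<beta> ^ k * \<eta> = \<epsilon> / 2" unfolding \<eta>_def using \<epsilon> \<beta> by auto
  have "\<eta> \<le> \<epsilon> / 2" using \<eta> \<beta>k by (metis less_eq_real_def mult_le_cancel_right1 mult.commute not_less)
  obtain n where n: "Q n < L + \<eta>"
    using order_tendstoD(2)[OF L(1), of "L + \<eta>"] \<eta> by (auto simp: eventually_sequentially)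
  define m where "m = n + k"
  obtain y z where yz: "L - \<eta> < P m m y z"
  proof -
    have "L - \<eta> < Q m" using L(2)[of m] \<eta> by linarith
    then have "\<exists>yz. L - \<eta> < (case yz of (y, z) \<Rightarrow> P m m y z)"
      unfolding Q_def by (subst (asm) less_cSUP_iff[OF _ bdd]) auto
    then show thesis using that by auto
  qed
  \<comment> \<open>The gap \<open>f\<close> below the ceiling \<open>L + \<eta>\<close> is
    nonnegative and has mean at most 2\<zeta>. An atom of mass at least \<open>\<alpha>\<close> can
    therefore carry a gap of at most 2\<zeta>/\<alpha>.\<close>
  have step: "L - \<beta> * \<zeta> \<le> P i m (act (inv (pick a b t)) y') z"
    if "L - \<zeta> \<le> P (Suc i) m y' z" "\<eta> \<le> \<zeta>" "n \<le> i" "i \<le> m" for i y' t \<zeta>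
  proof -
    let ?c = "pick a b t"
    define f where "f g = L + \<eta> - P i m (act (inv g) y') z" for g
    have f0: "0 \<le> f g" for g
      using PQ[OF that(4), of "act (inv g) y'" z] decseqD[OF dec that(3)] n unfolding f_def by linarith
    have fB: "\<bar>f g\<bar> \<le> L + \<eta>" for g using f0[of g] P01(1)[of i m "act (inv g) y'" z] unfolding f_def by linarith
    have "pmf \<nu> ?c * f ?c = measure_pmf.expectation \<nu> (\<lambda>g. indicator {?c} g * f ?c)"
      by (simp add: measure_pmf_single)
    also have "\<dots> \<le> measure_pmf.expectation \<nu> f"
      by (rule expectation_mono[where B = "L + \<eta>" and C = "L + \<eta>"])
        (use fB f0 in \<open>auto simp: indicator_def abs_mult intro: order_trans\<close>)
    also have "\<dots> = L + \<eta> - P (Suc i) m y' z"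
      unfolding f_def rec
      by (subst Bochner_Integration.integral_diff) (use P01 in \<open>auto intro!: integrable_pmf_bounded[where B = 1]\<close>)
    also have "\<dots> \<le> 2 * \<zeta>" using that by linarith
    finally have "pmf \<nu> ?c * f ?c \<le> 2 * \<zeta>" .
    moreover have "\<alpha> \<le> pmf \<nu> ?c" unfolding \<alpha>_def pick_def by auto
    ultimately have "\<alpha> * f ?c \<le> 2 * \<zeta>" using f0[of ?c] by (meson mult_right_mono order.trans)
    then have "f ?c \<le> \<beta> * \<zeta>" unfolding \<beta>_def using \<alpha> by (simp add: field_simps)
    then show ?thesis unfolding f_def using \<eta> by linarith
  qed
  have words: "L - \<beta> ^ length w * \<eta> \<le> P (m - length w) m (fold (\<lambda>t. act (inv (pick a b t))) w y) z"
    if "length w \<le> k" for w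
    using that
  proof (induction w rule: rev_induct)
    case Nil
    then show ?case using yz by simp
  next
    case (snoc t w)
    have "L - \<beta> * (\<beta> ^ length w * \<eta>)
        \<le> P (m - Suc (length w)) m (act (inv (pick a b t)) (fold (\<lambda>t. act (inv (pick a b t))) w y)) z"
    proof (rule step)
      show "L - \<beta> ^ length w * \<eta> \<le> P (Suc (m - Suc (length w))) m (fold (\<lambda>t. act (inv (pick a b t))) w y) z"
        using snoc by (simp add: m_def Suc_diff_Suc)
      show "\<eta> \<le> \<beta> ^ length w * \<eta>" using \<beta> \<eta> by simp
    qed (use snoc in \<open>auto simp: m_def\<close>)
    then show ?case by (simp add: mult.assoc)
  qed
  define F where "F = {w :: bool list. length w = k}"
  have F: "finite F" "card F = 2 ^ k"
    unfolding F_def using finite_lists_length_eq[of "UNIV :: bool set" k] card_lists_length_eq[of "UNIV :: bool set" k]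
    by auto
  let ?u = "\<lambda>w. fold (\<lambda>t. act (inv (pick a b t))) w y"
  \<comment> \<open>Double counting: the sum of the probabilities over all words is the expected
    number of words whose event occurs, and for each outcome \<open>v\<close> that number is at most
    \<open>j\<close>.\<close>
  have "2 ^ k * (L - \<epsilon> / 2) = (\<Sum>w\<in>F. L - \<beta> ^ k * \<eta>)"
    using F \<eta> by simp
  also have "\<dots> \<le> (\<Sum>w\<in>F. P n m (?u w) z)"
  proof (rule sum_mono)
    fix w assume "w \<in> F"
    then show "L - \<beta> ^ k * \<eta> \<le> P n m (?u w) z" using words[of w] by (simp add: F_def m_def)
  qed
  also have "\<dots> = measure_pmf.expectation (W n) (\<lambda>v. \<Sum>w\<in>F. indicator {v. T m (act (inv v) (?u w)) z} v)"
    unfolding P_def by (subst Bochner_Integration.integral_sum)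
      (auto intro!: integrable_pmf_bounded[where B = 1] simp: indicator_def)
  also have "\<dots> \<le> real j"
  proof (rule expectation_le_const)
    fix v assume v: "v \<in> set_pmf (W n)"
    have "(\<Sum>w\<in>F. indicator {v. T m (act (inv v) (?u w)) z} v) = real (card {w\<in>F. T m (act (inv v) (?u w)) z})"
      using F by (simp add: indicator_def sum.If_cases Int_def)
    also have "\<dots> \<le> real (card {w. length w = k \<and> R (?u w) (act v z)})"
      using near[OF v] unfolding F_def m_def
      by (intro of_nat_mono card_mono finite_words) auto
    also have "\<dots> \<le> real j" using count by simp
    finally show "(\<Sum>w\<in>F. indicator {v. T m (act (inv v) (?u w)) z} v) \<le> real j" .
    then show "\<bar>\<Sum>w\<in>F. indicator {v. T m (act (inv v) (?u w)) z} v\<bar> \<le> real j"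
      by (simp add: sum_nonneg)
  qed
  finally have "L \<le> real j / 2 ^ k + \<epsilon> / 2" by (simp add: field_simps)
  then have "Q n \<le> real j / 2 ^ k + \<epsilon>" using n \<open>\<eta> \<le> \<epsilon> / 2\<close> by linarith
  then show thesis using PQ[of n n] that[of n] unfolding P_def by (meson order.refl order.trans)
qed

end

section \<open>Uniform drift and exponential moments\<close>

text \<open>For negative \<open>t\<close> it suffices that 1 - u + u^2 times the quadratic Taylor
  bound of \<open>exp u\<close> is at least 1, where u = -t.\<close>

lemma exp_le_quadratic:
  fixes t :: real
  assumes "t \<le> 1"
  shows "exp t \<le> 1 + t + t\<^sup>2"
proof (cases "t \<ge> 0")
  case True
  then show ?thesis using exp_bound assms by simp
next
  case False
  define u where "u = - t"
  have u: "u > 0" using False u_def by simp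
  have "1 \<le> 1 + u\<^sup>2 / 2 + u ^ 3 / 2 + u ^ 4 / 2" using u by simp
  also have "\<dots> = (1 - u + u\<^sup>2) * (1 + u + u\<^sup>2 / 2)" by (simp add: field_simps power2_eq_square power3_eq_cube power4_eq_xxxx)
  also have "\<dots> \<le> (1 - u + u\<^sup>2) * exp u"
  proof (rule mult_left_mono)
    show "1 + u + u\<^sup>2 / 2 \<le> exp u" using exp_lower_Taylor_quadratic u by simp
    have "0 \<le> (1 - u / 2)\<^sup>2 + 3 / 4 * u\<^sup>2" by simp
    then show "0 \<le> 1 - u + u\<^sup>2" by (simp add: power2_eq_square field_simps)
  qed
  finally have "exp (- u) \<le> 1 - u + u\<^sup>2" by (simp add: exp_minus field_simps)
  then show ?thesis unfolding u_def by simp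
qed

context hyperbolic_walk
begin

text \<open>Conditioning on the last block instead of the first; the blocks are independent and may
  be drawn in either order.\<close>

lemma walk_add':
  "W (m + n) = bind_pmf (W n) (\<lambda>b. map_pmf (\<lambda>a. a \<otimes> b) (W m))"
  unfolding walk_add map_pmf_def by (rule bind_commute_pmf)

lemma expectation_walk_add:
  fixes f :: "'g \<Rightarrow> real"
  assumes "\<And>w. w \<in> set_pmf (W (m + n)) \<Longrightarrow> \<bar>f w\<bar> \<le> B"
  shows "measure_pmf.expectation (W (m + n)) f
    = measure_pmf.expectation (W m) (\<lambda>a. measure_pmf.expectation (W n) (\<lambda>b. f (a \<otimes> b)))"
  using expectation_bind[of "W m" "\<lambda>a. map_pmf (\<lambda>b. a \<otimes> b) (W n)" f B] assms
  unfolding walk_add by simp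

lemma expectation_walk_add':
  fixes f :: "'g \<Rightarrow> real"
  assumes "\<And>w. w \<in> set_pmf (W (m + n)) \<Longrightarrow> \<bar>f w\<bar> \<le> B"
  shows "measure_pmf.expectation (W (m + n)) f
    = measure_pmf.expectation (W n) (\<lambda>b. measure_pmf.expectation (W m) (\<lambda>a. f (a \<otimes> b)))"
  using expectation_bind[of "W n" "\<lambda>b. map_pmf (\<lambda>a. a \<otimes> b) (W m)" f B] assms
  unfolding walk_add' by simp

lemma walk_add_support:
  "a \<in> set_pmf (W m) \<Longrightarrow> b \<in> set_pmf (W n) \<Longrightarrow> a \<otimes> b \<in> set_pmf (W (m + n))"
  unfolding walk_add by auto

text \<open>A horofunction-like cocycle (\<open>displ_mult\<close>). At \<open>y = x\<close> it is
  \<open>len\<close>, and in general it falls short of \<open>len\<close> by twice a Gromov product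
  (\<open>displ_gp\<close>).\<close>

definition displ :: "'a \<Rightarrow> 'g \<Rightarrow> real" where
  "displ y w = dist y (act w x) - dist y x"

lemma displ_mult:
  "a \<in> carrier G \<Longrightarrow> b \<in> carrier G \<Longrightarrow> displ y (a \<otimes> b) = displ y a + displ (act (inv a) y) b"
  unfolding displ_def by (simp add: act_mult dist_act_inv)

lemma displ_abs_le: "\<bar>displ y w\<bar> \<le> len w"
  unfolding displ_def using dist_triangle[of y "act w x" x] dist_triangle[of y x "act w x"]
  by (auto simp: dist_commute abs_le_iff)

lemma displ_walk: "w \<in> set_pmf (W n) \<Longrightarrow> \<bar>displ y w\<bar> \<le> real n * D"
  using displ_abs_le[of y w] walk_len[of w n] by linarith

lemma displ_gp: "displ y w = len w - 2 * gp y (act w x)"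
  unfolding displ_def gromov_product_def by (simp add: dist_commute field_simps)

lemma gp_walk_le: "w \<in> set_pmf (W n) \<Longrightarrow> gp y (act w x) \<le> real n * D"
  using gromov_product_le(2)[of x y "act w x"] walk_len[of w n] by simp

text \<open>The signs \<open>\<sigma> = 1\<close> and \<open>\<sigma> = -1\<close> yield lower and upper deviation bounds, respectively.\<close>

lemma displ_chernoff:
  assumes \<sigma>: "\<bar>\<sigma>\<bar> = (1::real)" and c: "\<And>y. c \<le> measure_pmf.expectation (W M) (\<lambda>w. \<sigma> * displ y w)"
    and c': "c' < c"
  obtains s where "s > 0" 
    "\<And>k y. measure_pmf.expectation (W (k * M)) (\<lambda>w. exp (- s * (\<sigma> * displ y w))) \<le> exp (- s * c' * real k)"
proof -
  define B where "B = real M * D"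
  have B: "0 \<le> B" unfolding B_def using D_nonneg by simp
  have bd: "\<bar>\<sigma> * displ y w\<bar> \<le> real n * D" if "w \<in> set_pmf (W n)" for y w n
    using displ_walk[OF that] \<sigma> by (simp add: abs_mult)
  \<comment> \<open>The first entry makes s B \<le> 1, as \<open>exp_le_quadratic\<close> requires;
    the second makes s B^2 \<le> c - c', so that the quadratic error uses up only the slack between
    \<open>c\<close> and \<open>c'\<close>.\<close>
  define s where "s = min (1 / (B + 1)) ((c - c') / (B\<^sup>2 + 1))"
  have s: "s > 0" unfolding s_def using B c' by (auto simp: add_nonneg_pos)
  have "s * B \<le> 1 / (B + 1) * B" unfolding s_def using B by (intro mult_right_mono) auto
  also have "\<dots> \<le> 1" using B by simp
  finally have sB: "s * B \<le> 1" .
  have "s * B\<^sup>2 \<le> (c - c') / (B\<^sup>2 + 1) * B\<^sup>2" unfolding s_def using B by (intro mult_right_mono) auto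
  also have "\<dots> = (c - c') * (B\<^sup>2 / (B\<^sup>2 + 1))" by simp
  also have "\<dots> \<le> (c - c') * 1" using c' by (intro mult_left_mono) (auto simp: add_nonneg_pos)
  also have "\<dots> = c - c'" by simp
  finally have sB2: "s * B\<^sup>2 \<le> c - c'" .
  have eb: "\<bar>exp (- s * (\<sigma> * displ y w))\<bar> \<le> exp (s * (real n * D))" if "w \<in> set_pmf (W n)" for y w n
  proof -
    have "- s * (\<sigma> * displ y w) \<le> s * (real n * D)"
      using bd[OF that, of y] s by (metis abs_le_D2 minus_mult_commute mult_left_mono less_imp_le)
    then show ?thesis by simp
  qed
  have one: "measure_pmf.expectation (W M) (\<lambda>w. exp (- s * (\<sigma> * displ y w))) \<le> exp (- s * c')" for y
  proof -
    have "measure_pmf.expectation (W M) (\<lambda>w. exp (- s * (\<sigma> * displ y w)))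
        \<le> measure_pmf.expectation (W M) (\<lambda>w. 1 - s * (\<sigma> * displ y w) + s * (s * B\<^sup>2))"
    proof (rule expectation_mono)
      fix w assume w: "w \<in> set_pmf (W M)"
      show "\<bar>exp (- s * (\<sigma> * displ y w))\<bar> \<le> exp (s * (real M * D))" by (rule eb[OF w])
      have t: "\<bar>s * (\<sigma> * displ y w)\<bar> \<le> s * B"
        using bd[OF w, of y] s unfolding B_def by (simp add: abs_mult mult_left_mono)
      have "exp (- s * (\<sigma> * displ y w)) \<le> 1 + (- s * (\<sigma> * displ y w)) + (- s * (\<sigma> * displ y w))\<^sup>2"
        by (rule exp_le_quadratic) (use t sB in linarith)
      moreover have "(- s * (\<sigma> * displ y w))\<^sup>2 \<le> (s * B)\<^sup>2"
        using t by (metis abs_le_square_iff abs_of_nonneg abs_minus_cancel abs_ge_zero mult_minus_left order.trans)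
      ultimately show "exp (- s * (\<sigma> * displ y w)) \<le> 1 - s * (\<sigma> * displ y w) + s * (s * B\<^sup>2)"
        by (simp add: power2_eq_square algebra_simps)
      show "\<bar>1 - s * (\<sigma> * displ y w) + s * (s * B\<^sup>2)\<bar> \<le> 1 + s * B + \<bar>s * (s * B\<^sup>2)\<bar>"
        using t by linarith
    qed
    also have "\<dots> = 1 - s * measure_pmf.expectation (W M) (\<lambda>w. \<sigma> * displ y w) + s * (s * B\<^sup>2)"
      using integrable_pmf_bounded[of "W M" "\<lambda>w. \<sigma> * displ y w" "real M * D"] bd by simp
    also have "\<dots> \<le> 1 - s * c + s * (c - c')"
      using mult_left_mono[OF c[of y], of s] mult_left_mono[OF sB2, of s] s by linarith
    also have "\<dots> = 1 + (- s * c')" by (simp add: algebra_simps)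
    also have "\<dots> \<le> exp (- s * c')" by (rule exp_ge_add_one_self)
    finally show ?thesis .
  qed
  have "measure_pmf.expectation (W (k * M)) (\<lambda>w. exp (- s * (\<sigma> * displ y w))) \<le> exp (- s * c' * real k)" for k y
  proof (induction k arbitrary: y)
    case 0
    then show ?case by (simp add: displ_def)
  next
    case (Suc k)
    have "measure_pmf.expectation (W (M + k * M)) (\<lambda>w. exp (- s * (\<sigma> * displ y w)))
        = measure_pmf.expectation (W M) (\<lambda>a. measure_pmf.expectation (W (k * M))
            (\<lambda>b. exp (- s * (\<sigma> * displ y (a \<otimes> b)))))"
      using eb by (rule expectation_walk_add)
    also have "\<dots> \<le> measure_pmf.expectation (W M) (\<lambda>a. exp (- s * (\<sigma> * displ y a)) * exp (- s * c' * real k))"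
    proof (rule expectation_mono)
      fix a assume a: "a \<in> set_pmf (W M)"
      show "\<bar>measure_pmf.expectation (W (k * M)) (\<lambda>b. exp (- s * (\<sigma> * displ y (a \<otimes> b))))\<bar>
          \<le> exp (s * (real (M + k * M) * D))"
        by (rule expectation_abs_le, rule eb) (rule walk_add_support[OF a])
      show "\<bar>exp (- s * (\<sigma> * displ y a)) * exp (- s * c' * real k)\<bar>
          \<le> exp (s * (real M * D)) * exp (- s * c' * real k)"
        using eb[OF a, of y] by (simp add: abs_mult)
      have "measure_pmf.expectation (W (k * M)) (\<lambda>b. exp (- s * (\<sigma> * displ y (a \<otimes> b))))
          = measure_pmf.expectation (W (k * M))
              (\<lambda>b. exp (- s * (\<sigma> * displ y a)) * exp (- s * (\<sigma> * displ (act (inv a) y) b)))"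
        by (intro integral_cong_AE)
          (use a walk_closed in \<open>auto simp: AE_measure_pmf_iff displ_mult algebra_simps simp flip: exp_add\<close>)
      also have "\<dots> = exp (- s * (\<sigma> * displ y a))
          * measure_pmf.expectation (W (k * M)) (\<lambda>b. exp (- s * (\<sigma> * displ (act (inv a) y) b)))"
        by simp
      also have "\<dots> \<le> exp (- s * (\<sigma> * displ y a)) * exp (- s * c' * real k)"
        by (intro mult_left_mono Suc.IH) simp
      finally show "measure_pmf.expectation (W (k * M)) (\<lambda>b. exp (- s * (\<sigma> * displ y (a \<otimes> b))))
          \<le> exp (- s * (\<sigma> * displ y a)) * exp (- s * c' * real k)" .
    qed
    also have "\<dots> = measure_pmf.expectation (W M) (\<lambda>a. exp (- s * (\<sigma> * displ y a))) * exp (- s * c' * real k)"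
      by simp
    also have "\<dots> \<le> exp (- s * c') * exp (- s * c' * real k)"
      by (intro mult_right_mono one) simp
    also have "\<dots> = exp (- s * c' * real (Suc k))"
      by (simp add: algebra_simps flip: exp_add)
    finally show ?case by simp
  qed
  with s show thesis by (rule that)
qed

section \<open>Non-concentration of the walk\<close>

lemma schottky_in_walk:
  assumes "non_elementary G act x \<nu>"
  obtains \<kappa> where "\<And>R. \<exists>N. \<exists>a\<in>set_pmf (W N). \<exists>b\<in>set_pmf (W N). schottky_pair \<kappa> R a b"
proof -
  obtain g h where gh: "g \<in> gen_semigroup G (set_pmf \<nu>)" "h \<in> gen_semigroup G (set_pmf \<nu>)"
    "transl_len G act x g > 0" "transl_len G act x h > 0"
    "boundary_fixpoints x (act g) \<inter> boundary_fixpoints x (act h) = {}"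
    using assms unfolding non_elementary_def by blast
  obtain m where m: "m > 0" "g \<in> set_pmf (W m)" using gen_semigroup_in_walk[OF gh(1)] .
  obtain n where n: "n > 0" "h \<in> set_pmf (W n)" using gen_semigroup_in_walk[OF gh(2)] .
  obtain \<kappa> p q where pq: "p > 0" "q > 0"
    "\<And>R. \<exists>N. \<forall>i\<ge>N. \<forall>j\<ge>N. schottky_pair \<kappa> R (g [^] (p * i :: nat)) (h [^] (q * j :: nat))"
    using schottky_powers[OF walk_closed[OF m(2)] gh(3) walk_closed[OF n(2)] gh(4,5)] by metis
  show thesis
  proof
    fix R
    obtain N where N: "\<And>i j. i \<ge> N \<Longrightarrow> j \<ge> N \<Longrightarrow> schottky_pair \<kappa> R (g [^] (p * i)) (h [^] (q * j))"
      using pq(3) by blast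
    \<comment> \<open>With these exponents both powers are products of p q m n N steps, hence lie in
      the support at the same time.\<close>
    define i where "i = q * n * N"
    define j where "j = p * m * N"
    have "i \<ge> N" "j \<ge> N" unfolding i_def j_def using pq m n by auto
    then have "schottky_pair \<kappa> R (g [^] (p * i)) (h [^] (q * j))" by (rule N)
    moreover have "g [^] (p * i) \<in> set_pmf (W (p * i * m))" by (rule pow_in_walk[OF m(2)])
    moreover have "h [^] (q * j) \<in> set_pmf (W (p * i * m))"
      using pow_in_walk[OF n(2), of "q * j"] by (simp add: i_def j_def mult_ac)
    ultimately show "\<exists>N. \<exists>a\<in>set_pmf (W N). \<exists>b\<in>set_pmf (W N). schottky_pair \<kappa> R a b" by blast
  qed
qed

text \<open>Words of length 4 give 5/16, and an error of 1/16 makes 3/8. What matters later is that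
  this is below 1/2.\<close>

lemma nonconcentration:
  assumes "non_elementary G act x \<nu>" and r: "0 \<le> r"
  obtains N C where "\<And>y z. measure_pmf.prob (W N)
      {w. dist (act (inv w) y) z \<le> r \<or> C < gp (act (inv w) y) z} \<le> 3 / 8"
proof -
  obtain \<kappa> where \<kappa>: "\<And>R. \<exists>N. \<exists>a\<in>set_pmf (W N). \<exists>b\<in>set_pmf (W N). schottky_pair \<kappa> R a b"
    using schottky_in_walk[OF assms(1)] by blast
  obtain N a b where ab: "a \<in> set_pmf (W N)" "b \<in> set_pmf (W N)"
    "schottky_pair \<kappa> (2 * (\<kappa> + 2 * \<delta> + 1) + r) a b"
    using \<kappa> by blast
  interpret V: hyperbolic_walk G act x \<delta> "W N" "real N * D"
    by (rule hyperbolic_walk_walk)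
  define C where "C = \<kappa> + 2 * \<delta> + 1 + real 4 * max (len a) (len b)"
  have nonneg: "0 \<le> real N * D" using D_nonneg by simp
  \<comment> \<open>The threshold rises with \<open>n\<close> by the largest length of a block, so
    moving \<open>n\<close> blocks from the starting point over to \<open>z\<close> still leaves a
    product above \<open>C\<close>.\<close>
  obtain n where "\<And>y z. measure_pmf.prob (V.W n)
     {w. dist (act (inv w) y) z \<le> r \<or> C + real n * (real N * D) < gp (act (inv w) y) z}
     \<le> real (4 + 1) / 2 ^ 4 + 1 / 16"
  proof (rule V.concentration_bound[OF ab(1,2), where k = 4 and j = "4 + 1" and \<epsilon> = "1 / 16"
        and T = "\<lambda>n u z. dist u z \<le> r \<or> C + real n * (real N * D) < gp u z"
        and R = "\<lambda>u z. dist u z \<le> r \<or> C < gp u z"])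
    fix n u z
    assume "dist u z \<le> r \<or> C + real (Suc n) * (real N * D) < gp u z"
    then show "dist u z \<le> r \<or> C + real n * (real N * D) < gp u z"
      using nonneg by (auto simp: algebra_simps)
  next
    fix n w u z
    assume w: "w \<in> set_pmf (V.W n)"
      and T: "dist (act (inv w) u) z \<le> r \<or> C + real (n + 4) * (real N * D) < gp (act (inv w) u) z"
    have "real n * (real N * D) \<le> real (n + 4) * (real N * D)" using nonneg by (intro mult_right_mono) auto
    then show "dist u (act w z) \<le> r \<or> C < gp u (act w z)"
      using T V.walk_len[OF w] V.walk_closed[OF w] gp_act_inv_le[of w u z] by (auto simp: dist_act_inv)
  next
    fix y z
    show "card {w. length w = 4 \<and> (dist (fold (\<lambda>t. act (inv pick a b t)) w y) z \<le> r
        \<or> C < gp (fold (\<lambda>t. act (inv pick a b t)) w y) z)} \<le> 4 + 1"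
      by (rule schottky_count[OF ab(3) r refl refl, of "max (len a) (len b)"]) (auto simp: C_def)
  qed auto
  then show thesis unfolding walk_walk by (intro that[of "n * N"]) (simp_all)
qed

end

lemma pmf_exp_markov:
  fixes f :: "'c \<Rightarrow> real"
  assumes s: "0 \<le> s" and B: "\<And>a. a \<in> set_pmf p \<Longrightarrow> f a \<le> B"
  shows "measure_pmf.prob p {a. t < f a} \<le> exp (- s * t) * measure_pmf.expectation p (\<lambda>a. exp (s * f a))"
proof -
  have "measure_pmf.prob p {a. t < f a} = measure_pmf.expectation p (indicator {a. t < f a})"
    by simp
  also have "\<dots> \<le> measure_pmf.expectation p (\<lambda>a. exp (- s * t) * exp (s * f a))"
  proof (rule expectation_mono)
    fix a assume "a \<in> set_pmf p"
    then have "s * f a \<le> s * B" using B s by (simp add: mult_left_mono)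
    then show "\<bar>exp (- s * t) * exp (s * f a)\<bar> \<le> exp (- s * t) * exp (s * B)"
      by (simp add: abs_mult)
    show "\<bar>indicator {a. t < f a} a :: real\<bar> \<le> 1" by (simp add: indicator_def)
    show "indicator {a. t < f a} a \<le> exp (- s * t) * exp (s * f a)"
    proof (cases "t < f a")
      case True
      then have "0 \<le> - s * t + s * f a" using s by (simp add: mult_left_mono)
      then show ?thesis using True by (simp flip: exp_add)
    qed simp
  qed
  also have "\<dots> = exp (- s * t) * measure_pmf.expectation p (\<lambda>a. exp (s * f a))" by simp
  finally show ?thesis .
qed

locale nonelementary_walk = hyperbolic_walk +
  assumes nonelem: "non_elementary G act x \<nu>"
begin

text \<open>After a first block \<open>b\<close>, the element \<open>v\<close> contributes
  \<open>len v\<close> minus twice a Gromov product. That product is at most \<open>C\<close> except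
  with probability 3/8, and at most \<open>len v\<close> always; on average the fraction 1 - 2 * 3/8
  = 1/4 of \<open>len v\<close> survives.\<close>

lemma displ_walk_add_ge:
  assumes bad: "\<And>y z. measure_pmf.prob (W N) {w. C < gp (act (inv w) y) z} \<le> 3 / 8"
    and C: "0 \<le> C" and v: "v \<in> carrier G"
  shows "len v / 4 - (real N * D + 2 * C) \<le> measure_pmf.expectation (W N) (\<lambda>b. displ y (b \<otimes> v))"
proof -
  let ?A = "{w. C < gp (act (inv w) y) (act v x)}"
  have int: "integrable (measure_pmf (W N)) (\<lambda>b. 2 * len v * indicator ?A b :: real)"
    by (rule integrable_pmf_bounded[where B = "2 * len v"]) (auto simp: indicator_def)
  have "len v / 4 \<le> len v * (1 - 2 * measure_pmf.prob (W N) ?A)"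
    using mult_left_mono[of "1 / 4" "1 - 2 * measure_pmf.prob (W N) ?A" "len v"] bad[of y "act v x"] by simp
  then have "len v / 4 - (real N * D + 2 * C)
      \<le> len v - (real N * D + 2 * C) - 2 * len v * measure_pmf.prob (W N) ?A"
    by (simp add: algebra_simps)
  also have "\<dots> = measure_pmf.expectation (W N)
      (\<lambda>b. len v - (real N * D + 2 * C) - 2 * len v * indicator ?A b)"
    using int by simp
  also have "\<dots> \<le> measure_pmf.expectation (W N) (\<lambda>b. displ y (b \<otimes> v))"
  proof (rule expectation_mono)
    fix b assume b: "b \<in> set_pmf (W N)"
    note bc = walk_closed[OF b]
    show "\<bar>len v - (real N * D + 2 * C) - 2 * len v * indicator ?A b\<bar>
        \<le> 3 * len v + \<bar>real N * D + 2 * C\<bar>"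
    proof -
      consider "indicator ?A b = (0 :: real)" | "indicator ?A b = (1 :: real)" by (cases "b \<in> ?A") auto
      then show ?thesis
      proof cases
        case 1
        show ?thesis unfolding 1 using zero_le_dist[of x "act v x"] by linarith
      next
        case 2
        show ?thesis unfolding 2 using zero_le_dist[of x "act v x"] by linarith
      qed
    qed
    show "\<bar>displ y (b \<otimes> v)\<bar> \<le> real N * D + len v"
      using displ_walk[OF b, of y] displ_abs_le[of "act (inv b) y" v]
      unfolding displ_mult[OF bc v] by linarith
    have "gp (act (inv b) y) (act v x) \<le> C + len v * indicator ?A b"
      using gromov_product_le(2)[of x "act (inv b) y" "act v x"] C by (auto simp: indicator_def)
    then show "len v - (real N * D + 2 * C) - 2 * len v * indicator ?A b \<le> displ y (b \<otimes> v)"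
      using displ_walk[OF b, of y] unfolding displ_mult[OF bc v] displ_gp[of "act (inv b) y" v] by linarith
  qed
  finally show ?thesis .
qed

lemma uniform_drift:
  obtains M where "M > 0" "\<And>y. 1 \<le> measure_pmf.expectation (W M) (displ y)"
proof -
  obtain N C0 where NC: "\<And>y z. measure_pmf.prob (W N)
      {w. dist (act (inv w) y) z \<le> 0 \<or> C0 < gp (act (inv w) y) z} \<le> 3 / 8"
    by (rule nonconcentration[OF nonelem order.refl]) blast
  define C where "C = max C0 0"
  have bad: "measure_pmf.prob (W N) {w. C < gp (act (inv w) y) z} \<le> 3 / 8" for y z
  proof -
    have "measure_pmf.prob (W N) {w. C < gp (act (inv w) y) z}
        \<le> measure_pmf.prob (W N) {w. dist (act (inv w) y) z \<le> 0 \<or> C0 < gp (act (inv w) y) z}"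
      by (rule measure_pmf.finite_measure_mono) (auto simp: C_def)
    then show ?thesis using NC[of y z] by linarith
  qed
  have C: "0 \<le> C" unfolding C_def by simp
  have ND: "0 \<le> real N * D" using D_nonneg by simp
  \<comment> \<open>Elements longer than \<open>r\<close> have probability at least 5/8, so the mean
    length is at least 5(1 + ND + 2C); a quarter of it exceeds the loss ND + 2C by at least
    1.\<close>
  define r where "r = 8 * (1 + (real N * D + 2 * C))"
  have r: "0 \<le> r" unfolding r_def using C ND by simp
  obtain n C1 where n: "\<And>y z. measure_pmf.prob (W n)
      {w. dist (act (inv w) y) z \<le> r \<or> C1 < gp (act (inv w) y) z} \<le> 3 / 8"
    by (rule nonconcentration[OF nonelem r]) blast
  have short: "measure_pmf.prob (W n) {w. len w \<le> r} \<le> 3 / 8"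
  proof -
    have "measure_pmf.prob (W n) {w. len w \<le> r}
        = measure_pmf.prob (W n) ({w. len w \<le> r} \<inter> set_pmf (W n))" by (simp add: measure_Int_set_pmf)
    also have "\<dots> \<le> measure_pmf.prob (W n) {w. dist (act (inv w) x) x \<le> r \<or> C1 < gp (act (inv w) x) x}"
      by (rule measure_pmf.finite_measure_mono) (auto simp: dist_commute dest!: walk_closed)
    also have "\<dots> \<le> 3 / 8" by (rule n)
    finally show ?thesis .
  qed
  have len_bd: "\<bar>len v\<bar> \<le> real n * D" if "v \<in> set_pmf (W n)" for v using walk_len[OF that] by simp
  have "5 / 8 * r \<le> r * (1 - measure_pmf.prob (W n) {w. len w \<le> r})"
    using mult_left_mono[of "5 / 8" "1 - measure_pmf.prob (W n) {w. len w \<le> r}" r] short r by simp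
  also have "\<dots> = measure_pmf.expectation (W n) (\<lambda>v. r * (1 - indicator {w. len w \<le> r} v))"
    using integrable_pmf_bounded[of "W n" "indicator {w. len w \<le> r}" 1] by (simp add: indicator_le_1)
  also have "\<dots> \<le> measure_pmf.expectation (W n) len"
    by (rule expectation_mono[where B = r, OF _ len_bd]) (use r in \<open>auto simp: indicator_def\<close>)
  finally have long: "5 / 8 * r \<le> measure_pmf.expectation (W n) len" .
  define M where "M = N + n"
  have main: "1 \<le> measure_pmf.expectation (W M) (displ y)" for y
  proof -
    have "1 \<le> measure_pmf.expectation (W n) len / 4 - (real N * D + 2 * C)"
    proof -
      have "5 * (1 + (real N * D + 2 * C)) \<le> measure_pmf.expectation (W n) len"
        using long unfolding r_def by simp
      then show ?thesis using C ND by (simp add: algebra_simps)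
    qed
    also have "\<dots> = measure_pmf.expectation (W n) (\<lambda>v. len v / 4 - (real N * D + 2 * C))"
      using integrable_pmf_bounded[of "W n" len "real n * D"] len_bd by simp
    also have "\<dots> \<le> measure_pmf.expectation (W n)
        (\<lambda>v. measure_pmf.expectation (W N) (\<lambda>b. displ y (b \<otimes> v)))"
    proof (rule expectation_mono)
      fix v assume v: "v \<in> set_pmf (W n)"
      show "\<bar>len v / 4 - (real N * D + 2 * C)\<bar> \<le> real n * D + (real N * D + 2 * C)"
        using len_bd[OF v] C ND zero_le_dist[of x "act v x"] by linarith
      show "\<bar>measure_pmf.expectation (W N) (\<lambda>b. displ y (b \<otimes> v))\<bar> \<le> real (N + n) * D"
        by (rule expectation_abs_le, rule displ_walk) (rule walk_add_support[OF _ v])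
      show "len v / 4 - (real N * D + 2 * C) \<le> measure_pmf.expectation (W N) (\<lambda>b. displ y (b \<otimes> v))"
        by (rule displ_walk_add_ge[OF bad C walk_closed[OF v]])
    qed
    also have "\<dots> = measure_pmf.expectation (W M) (displ y)"
      unfolding M_def by (rule expectation_walk_add'[symmetric, where B = "real (N + n) * D"]) (rule displ_walk)
    finally show ?thesis .
  qed
  have "M > 0"
  proof (rule ccontr)
    assume "\<not> M > 0"
    then show False using main[of x] by (simp add: displ_def)
  qed
  then show thesis using main by (rule that)
qed

text \<open>Let u and p be the images of \<open>y\<close> and \<open>x\<close> under
  \<open>inv b\<close>; the product on the left is that of u and \<open>z\<close> seen from p. If it
  is at most \<open>R\<close> when seen from \<open>x\<close>, changing the base gives 2R. Otherwise
  u and \<open>z\<close> branch beyond p as seen from \<open>x\<close>, and changing the base shifts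
  the product by at most \<open>\<delta> - displ y b\<close>.\<close>

lemma gp_act_exp_bound:
  assumes b: "b \<in> carrier G" "len b \<le> R" and s: "0 \<le> s"
  shows "exp (s * gp y (act b z))
    \<le> exp (s * (2 * R)) + exp (s * \<delta>) * (exp (- s * displ y b) * exp (s * gp (act (inv b) y) z))"
proof -
  define u where "u = act (inv b) y"
  define p where "p = act (inv b) x"
  have eq: "gp y (act b z) = gromov_product p u z"
    unfolding p_def u_def using gromov_product_act[of "inv b" x y "act b z"] b by simp
  have px: "dist p x \<le> R" unfolding p_def using b len_inv[of b] by (simp add: dist_commute)
  have up: "dist u p = dist y x" "dist u x = dist y (act b x)"
    unfolding u_def p_def using b by (simp_all add: dist_act_inv)
  show ?thesis
  proof (cases "gp u z \<le> R")
    case True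
    then have "gp y (act b z) \<le> 2 * R"
      unfolding eq using gromov_product_move_base[of p u z x] px by linarith
    then have "exp (s * gp y (act b z)) \<le> exp (s * (2 * R))" using s by (simp add: mult_left_mono)
    then show ?thesis by (smt (verit) exp_gt_zero mult_pos_pos)
  next
    case False
    have "gp p u \<le> dist x p" by (rule gromov_product_le)
    then have "gp p u - \<delta> \<le> gp p z" using gp_hyp[of x p u z] False px by (simp add: dist_commute min_def split: if_splits)
    then have "gromov_product p u z \<le> gp u z + (dist u p - dist u x) + \<delta>"
      unfolding gromov_product_def by (simp add: dist_commute field_simps)
    then have "s * gp y (act b z) \<le> s * (gp u z + (dist u p - dist u x) + \<delta>)"
      unfolding eq using s by (rule mult_left_mono)
    also have "\<dots> = s * \<delta> + (- s * displ y b + s * gp u z)"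
      unfolding up displ_def by (simp add: algebra_simps)
    finally have "s * gp y (act b z) \<le> s * \<delta> + (- s * displ y b + s * gp u z)" .
    then have "exp (s * gp y (act b z)) \<le> exp (s * \<delta>) * (exp (- s * displ y b) * exp (s * gp u z))"
      by (simp flip: exp_add)
    then show ?thesis unfolding u_def by (smt (verit) exp_gt_zero)
  qed
qed

lemma gp_exp_moment:
  obtains s K where "s > 0" "\<And>n y. measure_pmf.expectation (W n) (\<lambda>w. exp (s * gp y (act w x))) \<le> K"
proof -
  obtain M where M: "M > 0" "\<And>y. 1 \<le> measure_pmf.expectation (W M) (displ y)" by (rule uniform_drift) blast
  obtain s where s: "s > 0" "\<And>k y. measure_pmf.expectation (W (k * M)) (\<lambda>w. exp (- s * displ y w)) \<le> exp (- s * (1 / 2) * real k)"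
    using displ_chernoff[of 1 1 M "1 / 2"] M(2) by (auto simp: mult.assoc)
  \<comment> \<open>So many blocks that exponential decay beats the factor
    \<open>exp (s * \<delta>)\<close> by 2: the recursion for the moment becomes a contraction with
    ratio 1/2.\<close>
  obtain k0 :: nat where k0: "real k0 > (s * \<delta> + ln 2) / (s / 2)" using reals_Archimedean2 by blast
  define k where "k = Suc k0"
  have "s * \<delta> + ln 2 \<le> s / 2 * real k"
  proof -
    have "(s * \<delta> + ln 2) / (s / 2) \<le> real k" using k0 unfolding k_def by simp
    then show ?thesis using s(1) by (simp add: field_simps)
  qed
  then have "exp (s * \<delta>) * exp (- s * (1 / 2) * real k) \<le> exp (- ln 2)"
    by (simp flip: exp_add)
  then have half: "exp (s * \<delta>) * exp (- s * (1 / 2) * real k) \<le> 1 / 2" by (simp add: exp_minus)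
  define N where "N = k * M"
  have N: "N > 0" unfolding N_def k_def using M by simp
  define R where "R = real N * D"
  have R: "0 \<le> R" unfolding R_def using D_nonneg by simp
  \<comment> \<open>The first entry makes \<open>exp (s * (2 * R)) + K / 2 \<le> K\<close>, which
    closes the recursion; the second covers walks shorter than one block.\<close>
  define K where "K = max (2 * exp (s * (2 * R))) (exp (s * R))"
  have K: "0 \<le> K" unfolding K_def by (simp add: le_max_iff_disj)
  have contr: "exp (s * \<delta>) * measure_pmf.expectation (W N) (\<lambda>w. exp (- s * displ y w)) \<le> 1 / 2" for y
    using order_trans[OF mult_left_mono[OF s(2)[of k y], of "exp (s * \<delta>)"] half] unfolding N_def by simp
  have eb: "\<bar>exp (s * gp y (act w x))\<bar> \<le> exp (s * (real n * D))" if "w \<in> set_pmf (W n)" for w n y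
    using gp_walk_le[OF that, of y] s(1) by simp
  have ed: "exp (- s * displ y b) \<le> exp (s * R)" if "b \<in> set_pmf (W N)" for b y
  proof -
    have "- displ y b \<le> R" using displ_walk[OF that, of y] unfolding R_def by linarith
    then have "s * (- displ y b) \<le> s * R" using s(1) by (intro mult_left_mono) auto
    then show ?thesis by simp
  qed
  have "measure_pmf.expectation (W n) (\<lambda>w. exp (s * gp y (act w x))) \<le> K" for n y
  proof (induction n arbitrary: y rule: less_induct)
    case (less n)
    show ?case
    proof (cases "n < N")
      case True
      show ?thesis
      proof (rule expectation_le_const)
        fix w assume w: "w \<in> set_pmf (W n)"
        show "\<bar>exp (s * gp y (act w x))\<bar> \<le> exp (s * (real n * D))" by (rule eb[OF w])
        also have "\<dots> \<le> exp (s * R)" unfolding R_def using True s(1) D_nonneg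
          by (simp add: mult_left_mono mult_right_mono)
        also have "\<dots> \<le> K" unfolding K_def by simp
        finally show "exp (s * gp y (act w x)) \<le> K" by simp
      qed
    next
      case False
      define m where "m = n - N"
      have m: "n = N + m" "m < n" using False N unfolding m_def by auto
      have "measure_pmf.expectation (W n) (\<lambda>w. exp (s * gp y (act w x)))
          = measure_pmf.expectation (W N) (\<lambda>b. measure_pmf.expectation (W m) (\<lambda>v. exp (s * gp y (act (b \<otimes> v) x))))"
        unfolding m(1) by (rule expectation_walk_add, rule eb)
      also have "\<dots> \<le> measure_pmf.expectation (W N)
          (\<lambda>b. exp (s * (2 * R)) + exp (s * \<delta>) * exp (- s * displ y b) * K)"
      proof (rule expectation_mono)
        fix b assume b: "b \<in> set_pmf (W N)"
        note bc = walk_closed[OF b]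
        have len_b: "len b \<le> R" unfolding R_def by (rule walk_len[OF b])
        show "\<bar>measure_pmf.expectation (W m) (\<lambda>v. exp (s * gp y (act (b \<otimes> v) x)))\<bar> \<le> exp (s * (real (N + m) * D))"
          by (rule expectation_abs_le, rule eb) (rule walk_add_support[OF b])
        have db: "exp (- s * displ y b) \<le> exp (s * R)"
          by (rule ed[OF b])
        show "\<bar>exp (s * (2 * R)) + exp (s * \<delta>) * exp (- s * displ y b) * K\<bar>
            \<le> exp (s * (2 * R)) + exp (s * \<delta>) * exp (s * R) * K"
        proof -
          have "exp (s * \<delta>) * exp (- s * displ y b) * K \<le> exp (s * \<delta>) * exp (s * R) * K"
            using db K by (intro mult_right_mono mult_left_mono) auto
          moreover have "0 \<le> exp (s * (2 * R)) + exp (s * \<delta>) * exp (- s * displ y b) * K"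
            using K by (intro add_nonneg_nonneg mult_nonneg_nonneg exp_ge_zero)
          ultimately show ?thesis by linarith
        qed
        have "measure_pmf.expectation (W m) (\<lambda>v. exp (s * gp y (act (b \<otimes> v) x)))
            \<le> measure_pmf.expectation (W m) (\<lambda>v. exp (s * (2 * R))
                + exp (s * \<delta>) * (exp (- s * displ y b) * exp (s * gp (act (inv b) y) (act v x))))"
        proof (rule expectation_mono)
          fix v assume v: "v \<in> set_pmf (W m)"
          show "\<bar>exp (s * gp y (act (b \<otimes> v) x))\<bar> \<le> exp (s * (real (N + m) * D))"
            by (rule eb[OF walk_add_support[OF b v]])
          show "\<bar>exp (s * (2 * R)) + exp (s * \<delta>) * (exp (- s * displ y b) * exp (s * gp (act (inv b) y) (act v x)))\<bar>
              \<le> exp (s * (2 * R)) + exp (s * \<delta>) * (exp (- s * displ y b) * exp (s * (real m * D)))"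
          proof -
            have "exp (s * gp (act (inv b) y) (act v x)) \<le> exp (s * (real m * D))"
              using eb[OF v, of "act (inv b) y"] by simp
            then have "exp (s * \<delta>) * (exp (- s * displ y b) * exp (s * gp (act (inv b) y) (act v x)))
              \<le> exp (s * \<delta>) * (exp (- s * displ y b) * exp (s * (real m * D)))"
              by (intro mult_left_mono) auto
            moreover have "0 \<le> exp (s * (2 * R))
                + exp (s * \<delta>) * (exp (- s * displ y b) * exp (s * gp (act (inv b) y) (act v x)))"
              by (intro add_nonneg_nonneg mult_nonneg_nonneg exp_ge_zero)
            ultimately show ?thesis by linarith
          qed
          show "exp (s * gp y (act (b \<otimes> v) x)) \<le> exp (s * (2 * R))
              + exp (s * \<delta>) * (exp (- s * displ y b) * exp (s * gp (act (inv b) y) (act v x)))"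
            using gp_act_exp_bound[OF bc len_b, of s y "act v x"] s(1) walk_closed[OF v] bc by (simp add: act_mult)
        qed
        also have "\<dots> = exp (s * (2 * R)) + exp (s * \<delta>) * (exp (- s * displ y b)
            * measure_pmf.expectation (W m) (\<lambda>v. exp (s * gp (act (inv b) y) (act v x))))"
          using integrable_pmf_bounded[of "W m" "\<lambda>v. exp (s * gp (act (inv b) y) (act v x))" "exp (s * (real m * D))"] eb
          by simp
        also have "\<dots> \<le> exp (s * (2 * R)) + exp (s * \<delta>) * (exp (- s * displ y b) * K)"
          by (intro add_left_mono mult_left_mono less.IH m) auto
        finally show "measure_pmf.expectation (W m) (\<lambda>v. exp (s * gp y (act (b \<otimes> v) x)))
            \<le> exp (s * (2 * R)) + exp (s * \<delta>) * exp (- s * displ y b) * K" by (simp add: mult.assoc)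
      qed
      also have "\<dots> = exp (s * (2 * R)) + exp (s * \<delta>) * measure_pmf.expectation (W N) (\<lambda>b. exp (- s * displ y b)) * K"
      proof -
        have "\<bar>exp (- s * displ y b)\<bar> \<le> exp (s * R)" if "b \<in> set_pmf (W N)" for b
          using ed[OF that, of y] by simp
        then show ?thesis
          using integrable_pmf_bounded[of "W N" "\<lambda>b. exp (- s * displ y b)" "exp (s * R)"] by simp
      qed
      also have "\<dots> \<le> exp (s * (2 * R)) + 1 / 2 * K"
        using mult_right_mono[OF contr[of y] K] by simp
      also have "\<dots> \<le> K" unfolding K_def by simp
      finally show ?thesis .
    qed
  qed
  with s(1) show thesis by (rule that)
qed

text \<open>The exponential Markov inequality gives the tail. The mean follows from t \<le> exp (s
  t) / s, whence the entry \<open>K / s\<close> in the common constant. Both bounds are uniform in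
  the number of steps.\<close>

lemma gp_tail:
  obtains s K where "s > 0" "\<And>n y t. measure_pmf.prob (W n) {w. t < gp y (act w x)} \<le> K * exp (- s * t)"
    "\<And>n y. measure_pmf.expectation (W n) (\<lambda>w. gp y (act w x)) \<le> K"
proof -
  obtain s K where s: "s > 0"
    and K: "\<And>n y. measure_pmf.expectation (W n) (\<lambda>w. exp (s * gp y (act w x))) \<le> K"
    by (rule gp_exp_moment) blast
  have tail: "measure_pmf.prob (W n) {w. t < gp y (act w x)} \<le> max K (K / s) * exp (- s * t)" for n y t
  proof -
    have "measure_pmf.prob (W n) {w. t < gp y (act w x)}
        \<le> exp (- s * t) * measure_pmf.expectation (W n) (\<lambda>w. exp (s * gp y (act w x)))"
      by (rule pmf_exp_markov) (use s gp_walk_le in auto)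
    also have "\<dots> \<le> exp (- s * t) * max K (K / s)" using K[of n y] by (intro mult_left_mono) auto
    finally show ?thesis by (simp add: mult.commute)
  qed
  have mean: "measure_pmf.expectation (W n) (\<lambda>w. gp y (act w x)) \<le> max K (K / s)" for n y
  proof -
    have "measure_pmf.expectation (W n) (\<lambda>w. gp y (act w x))
        \<le> measure_pmf.expectation (W n) (\<lambda>w. exp (s * gp y (act w x)) / s)"
    proof (rule expectation_mono)
      fix w assume w: "w \<in> set_pmf (W n)"
      show "\<bar>gp y (act w x)\<bar> \<le> real n * D" using gp_walk_le[OF w] gromov_product_nonneg[of x] by simp
      have "exp (s * gp y (act w x)) \<le> exp (s * (real n * D))" using gp_walk_le[OF w, of y] s by simp
      then show "\<bar>exp (s * gp y (act w x)) / s\<bar> \<le> exp (s * (real n * D)) / s"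
        using s by (simp add: divide_right_mono)
      show "gp y (act w x) \<le> exp (s * gp y (act w x)) / s"
      proof -
        have "s * gp y (act w x) \<le> exp (s * gp y (act w x))"
          using exp_ge_add_one_self[of "s * gp y (act w x)"] by linarith
        then show ?thesis using s by (simp add: field_simps)
      qed
    qed
    also have "\<dots> \<le> K / s" using K[of n y] s by (simp add: divide_right_mono)
    finally show ?thesis by simp
  qed
  show thesis by (rule that[OF s tail mean])
qed

end

section \<open>Sample paths\<close>

lemma summable_exp_neg:
  fixes c :: real
  assumes "c > 0" shows "summable (\<lambda>n. K * exp (- c * real n))"
proof -
  have "summable (\<lambda>n. exp (- c) ^ n)" using assms by (intro summable_geometric) simp
  then show ?thesis
    by (intro summable_mult) (simp add: mult.commute flip: exp_of_nat_mult)
qed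

text \<open>The two blocks are independent, so a bound valid for each fixed first block survives
  averaging over it.\<close>

lemma pmf_replicate_split:
  assumes "\<And>k. k \<in> set_pmf (replicate_pmf m p) \<Longrightarrow> measure_pmf.prob (replicate_pmf n p) {l. P k l} \<le> c"
  shows "measure_pmf.prob (replicate_pmf (m + n) p) {l. P (take m l) (drop m l)} \<le> c"
proof -
  have "measure_pmf.prob (bind_pmf (replicate_pmf n p) (\<lambda>ys. return_pmf (xs @ ys))) {l. P (take m l) (drop m l)} \<le> c"
    if xs: "xs \<in> set_pmf (replicate_pmf m p)" for xs
  proof -
    have "length xs = m" using xs by (simp add: set_replicate_pmf)
    then show ?thesis using assms[OF xs] unfolding map_pmf_def[symmetric] measure_map_pmf by simp
  qed
  then show ?thesis
    unfolding replicate_pmf_distrib prob_bind[of "replicate_pmf m p"]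
    by (intro expectation_le_const[where B = 1]) auto
qed

text \<open>The counterpart with the last block held fixed.\<close>

lemma pmf_replicate_split':
  assumes "\<And>l. l \<in> set_pmf (replicate_pmf n p) \<Longrightarrow> measure_pmf.prob (replicate_pmf m p) {k. P k l} \<le> c"
  shows "measure_pmf.prob (replicate_pmf (m + n) p) {l. P (take m l) (drop m l)} \<le> c"
proof -
  have "measure_pmf.prob (bind_pmf (replicate_pmf m p) (\<lambda>xs. return_pmf (xs @ ys))) {l. P (take m l) (drop m l)} \<le> c"
    if ys: "ys \<in> set_pmf (replicate_pmf n p)" for ys
  proof -
    have "measure_pmf.prob (bind_pmf (replicate_pmf m p) (\<lambda>xs. return_pmf (xs @ ys))) {l. P (take m l) (drop m l)}
        = measure_pmf.prob (replicate_pmf m p) {k. P k ys}"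
      unfolding map_pmf_def[symmetric] measure_map_pmf
      by (rule measure_pmf.finite_measure_eq_AE) (auto simp: AE_measure_pmf_iff set_replicate_pmf)
    then show ?thesis using assms[OF ys] by simp
  qed
  then show ?thesis
    unfolding replicate_pmf_distrib
    by (subst bind_commute_pmf, unfold prob_bind[of "replicate_pmf n p"])
      (intro expectation_le_const[where B = 1], auto)
qed

text \<open>The sigma algebra of \<open>stream_space (measure_pmf p)\<close> need not make \<open>stake n\<close> measurable into the
  power set when the underlying type is uncountable; countable sets of words suffice here.\<close>

lemma stake_stream_space:
  fixes p :: "'c pmf"
  assumes "countable A"
  shows "{\<omega>. stake n \<omega> \<in> A} \<in> sets (stream_space (measure_pmf p))"
    and "emeasure (stream_space (measure_pmf p)) {\<omega>. stake n \<omega> \<in> A} = emeasure (measure_pmf (replicate_pmf n p)) A"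
proof -
  let ?S = "stream_space (measure_pmf p)"
  have space: "space ?S = UNIV" by (simp add: space_stream_space)
  have single: "{\<omega>. stake n \<omega> = l} \<in> sets ?S" for l :: "'c list" and n
  proof (induction n arbitrary: l)
    case 0
    then show ?case using sets.top[of ?S] space by (cases "l = []") auto
  next
    case (Suc n)
    show ?case
    proof (cases l)
      case Nil
      then have "{\<omega>. stake (Suc n) \<omega> = l} = {}" by auto
      then show ?thesis by simp
    next
      case (Cons a k)
      have "{\<omega>. stake (Suc n) \<omega> = l} = (shd -` {a} \<inter> space ?S) \<inter> (stl -` {\<omega>. stake n \<omega> = k} \<inter> space ?S)"
        using Cons space by auto
      also have "\<dots> \<in> sets ?S"
        by (intro sets.Int measurable_sets[OF measurable_shd] measurable_sets[OF measurable_stl[where M = "measure_pmf p"]] Suc.IH) auto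
      finally show ?thesis .
    qed
  qed
  have meas: "{\<omega>. stake n \<omega> \<in> A} \<in> sets ?S" if "countable A" for A :: "'c list set" and n
  proof -
    have "{\<omega>. stake n \<omega> \<in> A} = (\<Union>l\<in>A. {\<omega>. stake n \<omega> = l})" by auto
    then show ?thesis using single that by (auto intro!: sets.countable_UN')
  qed
  then show "{\<omega>. stake n \<omega> \<in> A} \<in> sets ?S" using assms by blast
  interpret S: prob_space ?S by (rule prob_space.prob_space_stream_space[OF prob_space_measure_pmf])
  show "emeasure ?S {\<omega>. stake n \<omega> \<in> A} = emeasure (measure_pmf (replicate_pmf n p)) A"
    using assms
  proof (induction n arbitrary: A)
    case 0
    then show ?case using S.emeasure_space_1 space by (cases "[] \<in> A") auto
  next
    case (Suc n)
    have cnt: "countable {l. t # l \<in> A}" for t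
    proof -
      have "{l. t # l \<in> A} \<subseteq> tl ` A"
      proof
        fix l assume "l \<in> {l. t # l \<in> A}"
        then show "l \<in> tl ` A" by (intro image_eqI[of _ _ "t # l"]) auto
      qed
      then show ?thesis using Suc.prems countable_subset by blast
    qed
    have "emeasure ?S {\<omega>. stake (Suc n) \<omega> \<in> A}
        = (\<integral>\<^sup>+t. emeasure ?S {\<omega>. stake n \<omega> \<in> {l. t # l \<in> A}} \<partial>measure_pmf p)"
      by (subst prob_space.emeasure_stream_space[OF prob_space_measure_pmf meas[OF Suc.prems]]) (simp add: space)
    also have "\<dots> = (\<integral>\<^sup>+t. emeasure (measure_pmf (replicate_pmf n p)) {l. t # l \<in> A} \<partial>measure_pmf p)"
      by (simp only: Suc.IH[OF cnt])
    also have "\<dots> = emeasure (measure_pmf (replicate_pmf (Suc n) p)) A"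
      by (simp add: vimage_def flip: map_pmf_def)
    finally show ?case .
  qed
qed

lemma AE_stake_support:
  "AE \<omega> in stream_space (measure_pmf p). \<forall>n. stake n \<omega> \<in> set_pmf (replicate_pmf n p)"
proof -
  let ?S = "stream_space (measure_pmf p)"
  interpret S: prob_space ?S by (rule prob_space.prob_space_stream_space[OF prob_space_measure_pmf])
  have "AE \<omega> in ?S. stake n \<omega> \<in> set_pmf (replicate_pmf n p)" for n
  proof -
    have "emeasure ?S {\<omega>. stake n \<omega> \<in> set_pmf (replicate_pmf n p)} = 1"
      by (subst stake_stream_space(2)) (auto simp: measure_pmf.emeasure_eq_measure measure_pmf.prob_eq_1 AE_measure_pmf)
    then show ?thesis
      using S.AE_in_set_eq_1[OF stake_stream_space(1)[OF countable_set_pmf]]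
      by (auto simp: S.emeasure_eq_measure)
  qed
  then show ?thesis by (simp add: AE_all_countable)
qed

text \<open>Borel-Cantelli for events on prefixes. Cutting each event down to the countable support
  makes it measurable without changing its probability.\<close>

lemma AE_stake_eventually:
  assumes "summable (\<lambda>n. measure_pmf.prob (replicate_pmf (f n) p) {l. P n l})"
  shows "AE \<omega> in stream_space (measure_pmf p). \<forall>\<^sub>F n in sequentially. \<not> P n (stake (f n) \<omega>)"
proof -
  let ?S = "stream_space (measure_pmf p)"
  interpret S: prob_space ?S by (rule prob_space.prob_space_stream_space[OF prob_space_measure_pmf])
  define A where "A n = {l. P n l} \<inter> set_pmf (replicate_pmf (f n) p)" for n
  have cnt: "countable (A n)" for n unfolding A_def by (rule countable_Int2) (rule countable_set_pmf)
  have "measure ?S {\<omega>. stake (f n) \<omega> \<in> A n} = measure_pmf.prob (replicate_pmf (f n) p) {l. P n l}" for n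
    using stake_stream_space(2)[OF cnt[of n], where n = "f n" and p = p] unfolding A_def
    by (simp add: measure_def emeasure_Int_set_pmf)
  then have "AE \<omega> in ?S. \<forall>\<^sub>F n in sequentially. \<omega> \<in> space ?S - {\<omega>. stake (f n) \<omega> \<in> A n}"
    using assms by (intro borel_cantelli_AE1 stake_stream_space(1)[OF cnt]) (auto simp: less_top[symmetric])
  then show ?thesis using AE_stake_support[of p]
  proof eventually_elim
    case (elim \<omega>)
    then show ?case by (auto simp: A_def elim!: eventually_mono)
  qed
qed

text \<open>Deviations need control only along multiples of an \<open>m\<close> that may depend on
  the precision: the remainder modulo \<open>m\<close> changes \<open>a n\<close> by a bounded
  amount, which vanishes after division by \<open>n\<close>.\<close>

lemma lipschitz_average_limit:
  fixes a :: "nat \<Rightarrow> real"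
  assumes lip: "\<And>n r. \<bar>a (n + r) - a n\<bar> \<le> real r * D"
    and dev: "\<And>j. \<exists>m>0. \<forall>\<^sub>F k in sequentially. \<bar>a (k * m) - L * real (k * m)\<bar> \<le> real (k * m) / real (Suc j)"
  shows "(\<lambda>n. a n / real n) \<longlonglongrightarrow> L"
proof (rule LIMSEQ_I)
  fix e :: real assume e: "0 < e"
  obtain j where "inverse (real (Suc j)) < e / 2" using reals_Archimedean[of "e / 2"] e by auto
  then have j: "1 / real (Suc j) < e / 2" by (simp add: inverse_eq_divide)
  obtain m k0 where m: "m > 0"
    and k0: "\<And>k. k \<ge> k0 \<Longrightarrow> \<bar>a (k * m) - L * real (k * m)\<bar> \<le> real (k * m) / real (Suc j)"
    using dev[of j] by (auto simp: eventually_sequentially)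
  have D: "0 \<le> D" using lip[of 0 1] by (simp add: abs_le_iff)
  define B where "B = real m * (D + \<bar>L\<bar>)"
  have B: "0 \<le> B" unfolding B_def using D by simp
  obtain N :: nat where N: "real N > B / (e / 2)" using reals_Archimedean2 by blast
  show "\<exists>N. \<forall>n\<ge>N. norm (a n / real n - L) < e"
  proof (intro exI allI impI)
    fix n assume n: "Suc N + k0 * m \<le> n"
    define k where "k = n div m"
    define r where "r = n mod m"
    have nkr: "n = k * m + r" "r < m" unfolding k_def r_def using m by auto
    have "k0 * m \<le> n" using n by simp
    then have "k \<ge> k0" unfolding k_def using m by (simp add: less_eq_div_iff_mult_less_eq)
    then have 1: "\<bar>a (k * m) - L * real (k * m)\<bar> \<le> real (k * m) / real (Suc j)" by (rule k0)
    have "real (k * m) / real (Suc j) \<le> real n * (1 / real (Suc j))"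
      using nkr by (simp add: divide_right_mono)
    also have "\<dots> \<le> real n * (e / 2)" using j by (intro mult_left_mono) auto
    finally have 2: "real (k * m) / real (Suc j) \<le> real n * (e / 2)" .
    have 3: "\<bar>a n - a (k * m)\<bar> \<le> real r * D" using lip[of "k * m" r] nkr by simp
    have 4: "\<bar>L * real r\<bar> \<le> real r * \<bar>L\<bar>" by (simp add: abs_mult)
    have "real r * D + real r * \<bar>L\<bar> \<le> B"
      unfolding B_def distrib_left using nkr D by (intro add_mono mult_right_mono) auto
    moreover have "L * real n = L * real (k * m) + L * real r" using nkr by (simp add: algebra_simps)
    ultimately have "\<bar>a n - L * real n\<bar> \<le> real n * (e / 2) + B" using 1 2 3 4 by linarith
    moreover have "B < real n * (e / 2)"
    proof -
      have "B / (e / 2) < real n" using N n by linarith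
      then show ?thesis using e by (simp add: field_simps)
    qed
    ultimately have lt: "\<bar>a n - L * real n\<bar> < e * real n" by (simp add: algebra_simps)
    have n0: "real n > 0" using n by simp
    have "a n / real n - L = (a n - L * real n) / real n" using n0 by (simp add: field_simps)
    then show "norm (a n / real n - L) < e" using lt n0 by (simp add: field_simps)
  qed
qed

context hyperbolic_action
begin

text \<open>Consider the chain ax, abx, (ab)^(-1) x, b^(-1) x. By the complement identity the outer
  links have large products, while the two ends have product at most \<open>\<eta>\<close>; hence
  the middle link is at most \<open>\<eta> + 2 * \<delta>\<close>, and \<open>transl_len_ge\<close>
  applies. The second bound in \<open>big\<close> serves as a lower bound for
  \<open>len b\<close>.\<close>

lemma transl_len_mult_ge:
  assumes a: "a \<in> carrier G" and b: "b \<in> carrier G"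
    and \<eta>: "gp (act (inv a) x) (act b x) \<le> \<eta>" "gp (act a x) (act (inv b) x) \<le> \<eta>"
    and big: "2 * \<eta> + 2 * \<delta> < len a" "2 * \<eta> + 2 * \<delta> < len (a \<otimes> b) - len a"
  shows "len (a \<otimes> b) - 2 * \<eta> - 6 * \<delta> \<le> transl_len G act x (a \<otimes> b)"
proof -
  have ab: "a \<otimes> b \<in> carrier G" using a b by simp
  have inv_ab: "act (inv (a \<otimes> b)) x = act (inv b) (act (inv a) x)"
    using a b by (simp add: inv_mult_group act_mult)
  have "gp (act (a \<otimes> b) x) (act a x) = len a - gp (act b x) (act (inv a) x)"
    using gp_complement_inv[of "inv a" "act b x"] a b by (simp add: act_mult)
  then have 1: "\<eta> + 2 * \<delta> < gp (act a x) (act (a \<otimes> b) x)"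
    using \<eta>(1) big(1) by (simp add: gromov_product_commute)
  have "gp (act (inv (a \<otimes> b)) x) (act (inv b) x) = len b - gp (act (inv a) x) (act b x)"
    unfolding inv_ab by (rule gp_complement_inv[OF b])
  then have 2: "\<eta> + 2 * \<delta> < gp (act (inv (a \<otimes> b)) x) (act (inv b) x)"
    using \<eta>(1) big(2) len_mult[OF a b] by linarith
  have "gp (act (a \<otimes> b) x) (act (inv (a \<otimes> b)) x) \<le> \<eta> + 2 * \<delta>"
    using gp_hyp2[of "act a x" "act (a \<otimes> b) x" "act (inv (a \<otimes> b)) x" "act (inv b) x"] 1 2 \<eta>(2)
    by (auto simp: min_def split: if_splits)
  then show ?thesis using transl_len_ge[OF ab] by linarith
qed

end

section \<open>The drift and deviations of the length\<close>

context nonelementary_walk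
begin

lemma len_walk_bounded: "w \<in> set_pmf (W n) \<Longrightarrow> \<bar>len w\<bar> \<le> real n * D"
  using walk_len by simp

lemma drift:
  obtains L C where "L > 0" "(\<lambda>n. measure_pmf.expectation (W n) len / real n) \<longlonglongrightarrow> L"
    "\<And>n y. measure_pmf.expectation (W n) len - C \<le> measure_pmf.expectation (W n) (displ y)"
    "\<And>n y. measure_pmf.expectation (W n) (displ y) \<le> measure_pmf.expectation (W n) len"
proof -
  define e where "e n = measure_pmf.expectation (W n) len" for n
  note int_len = integrable_pmf_bounded[of "W _" len, OF len_walk_bounded]
  have "e (m + n) \<le> e m + e n" for m n
  proof -
    have "e (m + n) = measure_pmf.expectation (W m) (\<lambda>a. measure_pmf.expectation (W n) (\<lambda>b. len (a \<otimes> b)))"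
      unfolding e_def by (rule expectation_walk_add) (rule len_walk_bounded)
    also have "\<dots> \<le> measure_pmf.expectation (W m) (\<lambda>a. len a + e n)"
    proof (rule expectation_mono)
      fix a assume a: "a \<in> set_pmf (W m)"
      have en: "\<bar>e n\<bar> \<le> real n * D" unfolding e_def by (rule expectation_abs_le) (rule len_walk_bounded)
      show "\<bar>measure_pmf.expectation (W n) (\<lambda>b. len (a \<otimes> b))\<bar> \<le> real (m + n) * D"
        by (rule expectation_abs_le, rule len_walk_bounded) (rule walk_add_support[OF a])
      show "\<bar>len a + e n\<bar> \<le> real m * D + real n * D" using len_walk_bounded[OF a] en by linarith
      have "measure_pmf.expectation (W n) (\<lambda>b. len (a \<otimes> b)) \<le> measure_pmf.expectation (W n) (\<lambda>b. len a + len b)"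
      proof (rule expectation_mono)
        fix b assume b: "b \<in> set_pmf (W n)"
        show "\<bar>len (a \<otimes> b)\<bar> \<le> real (m + n) * D" by (rule len_walk_bounded[OF walk_add_support[OF a b]])
        show "\<bar>len a + len b\<bar> \<le> real m * D + real n * D"
          using len_walk_bounded[OF a] len_walk_bounded[OF b] by linarith
        show "len (a \<otimes> b) \<le> len a + len b" by (rule len_mult[OF walk_closed[OF a] walk_closed[OF b]])
      qed
      also have "\<dots> = len a + e n" unfolding e_def using int_len[of n] by simp
      finally show "measure_pmf.expectation (W n) (\<lambda>b. len (a \<otimes> b)) \<le> len a + e n" .
    qed
    also have "\<dots> = e m + e n" unfolding e_def using int_len[of m] by simp
    finally show ?thesis .
  qed
  moreover have "0 \<le> e n" for n unfolding e_def by (rule Bochner_Integration.integral_nonneg) simp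
  ultimately obtain L where L: "(\<lambda>n. e n / real n) \<longlonglongrightarrow> L" using fekete[of e] by blast
  obtain M where M: "M > 0" "\<And>y. 1 \<le> measure_pmf.expectation (W M) (displ y)" by (rule uniform_drift) blast
  \<comment> \<open>Each further block of \<open>M\<close> steps adds at least 1 to the mean length:
    the cocycle relation at \<open>x\<close> turns the increment into a displacement seen from
    \<open>act (inv a) x\<close>, where the uniform drift applies.\<close>
  have lin: "real k \<le> e (k * M)" for k
  proof (induction k)
    case (Suc k)
    have displ_x: "displ x = len" unfolding displ_def by auto
    have "e (k * M) + 1 = measure_pmf.expectation (W (k * M)) (\<lambda>a. len a + 1)"
      unfolding e_def using int_len[of "k * M"] by simp
    also have "\<dots> \<le> measure_pmf.expectation (W (k * M)) (\<lambda>a. measure_pmf.expectation (W M) (\<lambda>b. len (a \<otimes> b)))"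
    proof (rule expectation_mono)
      fix a assume a: "a \<in> set_pmf (W (k * M))"
      show "\<bar>len a + 1\<bar> \<le> real (k * M) * D + 1" using len_walk_bounded[OF a] by linarith
      show "\<bar>measure_pmf.expectation (W M) (\<lambda>b. len (a \<otimes> b))\<bar> \<le> real (k * M + M) * D"
        by (rule expectation_abs_le, rule len_walk_bounded) (rule walk_add_support[OF a])
      have "len a + 1 \<le> len a + measure_pmf.expectation (W M) (displ (act (inv a) x))" using M(2) by simp
      also have "\<dots> = measure_pmf.expectation (W M) (\<lambda>b. len a + displ (act (inv a) x) b)"
        using integrable_pmf_bounded[of "W M" "displ (act (inv a) x)" "real M * D"] displ_walk by simp
      also have "\<dots> = measure_pmf.expectation (W M) (\<lambda>b. len (a \<otimes> b))"
        by (intro integral_cong_AE)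
          (use walk_closed a displ_mult[of a _ x] in \<open>auto simp: AE_measure_pmf_iff displ_x\<close>)
      finally show "len a + 1 \<le> measure_pmf.expectation (W M) (\<lambda>b. len (a \<otimes> b))" .
    qed
    also have "\<dots> = e (k * M + M)"
      unfolding e_def by (rule expectation_walk_add[symmetric]) (rule len_walk_bounded)
    finally show ?case using Suc by (simp add: add.commute)
  qed (simp add: e_def)
  have "(\<lambda>k. e (k * M) / real (k * M)) \<longlonglongrightarrow> L"
    using LIMSEQ_subseq_LIMSEQ[OF L, of "\<lambda>k. k * M"] M(1) by (simp add: strict_mono_def o_def)
  moreover have "\<exists>N. \<forall>k\<ge>N. 1 / real M \<le> e (k * M) / real (k * M)"
  proof (intro exI allI impI)
    fix k :: nat assume "1 \<le> k"
    then show "1 / real M \<le> e (k * M) / real (k * M)" using lin[of k] M(1) by (simp add: field_simps)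
  qed
  ultimately have "1 / real M \<le> L" by (rule LIMSEQ_le_const)
  then have L0: "L > 0" using M(1) by (smt (verit) divide_pos_pos of_nat_0_less_iff)
  obtain s K where K: "\<And>n y. measure_pmf.expectation (W n) (\<lambda>w. gp y (act w x)) \<le> K"
    by (rule gp_tail) blast
  have lower: "e n - 2 * K \<le> measure_pmf.expectation (W n) (displ y)" for n y
  proof -
    have "measure_pmf.expectation (W n) (displ y) = measure_pmf.expectation (W n) (\<lambda>w. len w - 2 * gp y (act w x))"
      using displ_gp by presburger
    also have "\<dots> = e n - 2 * measure_pmf.expectation (W n) (\<lambda>w. gp y (act w x))"
      unfolding e_def using int_len[of n]
        integrable_pmf_bounded[of "W n" "\<lambda>w. gp y (act w x)" "real n * D"] gp_walk_le[of _ n y] gromov_product_nonneg[of x]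
      by simp
    finally show ?thesis using K[of n y] by simp
  qed
  have upper: "measure_pmf.expectation (W n) (displ y) \<le> e n" for n y
    unfolding e_def
    by (rule expectation_mono[OF displ_walk len_walk_bounded]) (use displ_abs_le in \<open>auto simp: abs_le_iff\<close>)
  show thesis by (rule that[OF L0 L[unfolded e_def] lower[unfolded e_def] upper[unfolded e_def]])
qed

text \<open>The Chernoff bound at \<open>y = x\<close>, with the midpoint of \<open>c'\<close> and
  \<open>c\<close> as rate: it must lie below \<open>c\<close> to be admissible and above
  \<open>c'\<close> to leave exponential decay.\<close>

lemma one_sided_deviation:
  assumes \<sigma>: "\<bar>\<sigma>\<bar> = (1::real)" and c: "\<And>y. c \<le> measure_pmf.expectation (W m) (\<lambda>w. \<sigma> * displ y w)"
    and c': "c' < c"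
  shows "summable (\<lambda>k. measure_pmf.prob (W (k * m)) {w. \<sigma> * len w < c' * real k})"
proof -
  obtain s where s: "s > 0" "\<And>k y. measure_pmf.expectation (W (k * m)) (\<lambda>w. exp (- s * (\<sigma> * displ y w)))
      \<le> exp (- s * ((c + c') / 2) * real k)"
    by (rule displ_chernoff[OF \<sigma> c, of "(c + c') / 2"]) (use c' in auto)
  have le: "measure_pmf.prob (W (k * m)) {w. \<sigma> * len w < c' * real k} \<le> 1 * exp (- (s * ((c - c') / 2)) * real k)" for k
  proof -
    have "measure_pmf.prob (W (k * m)) {w. \<sigma> * len w < c' * real k}
        = measure_pmf.prob (W (k * m)) {w. - c' * real k < - (\<sigma> * len w)}" by simp
    also have "\<dots> \<le> exp (- s * (- c' * real k)) * measure_pmf.expectation (W (k * m)) (\<lambda>w. exp (s * - (\<sigma> * len w)))"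
    proof (rule pmf_exp_markov)
      fix w assume "w \<in> set_pmf (W (k * m))"
      from len_walk_bounded[OF this] have "\<bar>\<sigma> * len w\<bar> \<le> real (k * m) * D" using \<sigma> by (simp add: abs_mult)
      then show "- (\<sigma> * len w) \<le> real (k * m) * D" by linarith
    qed (use s in simp)
    also have "\<dots> \<le> exp (- s * (- c' * real k)) * exp (- s * ((c + c') / 2) * real k)"
      using s(2)[of k x] by (intro mult_left_mono) (simp_all add: displ_def)
    also have "\<dots> = exp (- (s * ((c - c') / 2)) * real k)"
      unfolding exp_add[symmetric] by (rule arg_cong[where f = exp]) (simp add: field_simps)
    finally show ?thesis by simp
  qed
  have sum: "summable (\<lambda>k. 1 * exp (- (s * ((c - c') / 2)) * real k))"
    using s c' by (intro summable_exp_neg) simp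
  show ?thesis by (rule summable_comparison_test'[OF sum, where N = 0]) (use le in simp)
qed

lemma len_deviation:
  assumes L: "(\<lambda>n. measure_pmf.expectation (W n) len / real n) \<longlonglongrightarrow> L"
    and lower: "\<And>n y. measure_pmf.expectation (W n) len - C \<le> measure_pmf.expectation (W n) (displ y)"
    and upper: "\<And>n y. measure_pmf.expectation (W n) (displ y) \<le> measure_pmf.expectation (W n) len"
    and \<epsilon>: "0 < \<epsilon>"
  obtains m where "m > 0"
    "summable (\<lambda>k. measure_pmf.prob (W (k * m)) {w. \<not> \<bar>len w - L * real (k * m)\<bar> \<le> real (k * m) * \<epsilon>})"
proof -
  let ?e = "\<lambda>n. measure_pmf.expectation (W n) len"
  have "(\<lambda>n. ?e n / real n - C / real n) \<longlonglongrightarrow> L - 0"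
    by (intro tendsto_diff L lim_const_over_n)
  then have "\<forall>\<^sub>F n in sequentially. L - \<epsilon> < ?e n / real n - C / real n" "\<forall>\<^sub>F n in sequentially. ?e n / real n < L + \<epsilon>"
    using \<epsilon> L by (auto intro: order_tendstoD)
  then have "\<forall>\<^sub>F n in sequentially. L - \<epsilon> < ?e n / real n - C / real n \<and> ?e n / real n < L + \<epsilon> \<and> n > 0"
    using eventually_gt_at_top[of 0] by eventually_elim auto
  \<comment> \<open>The block must be long enough to absorb the constant \<open>C\<close>, the
    possible deficit of the mean displacement seen from a far away point.\<close>
  then obtain m where m: "m > 0" "L - \<epsilon> < ?e m / real m - C / real m" "?e m / real m < L + \<epsilon>"
    by (auto simp: eventually_sequentially)
  have m': "(L - \<epsilon>) * real m < ?e m - C" "- ((L + \<epsilon>) * real m) < - ?e m"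
    using m by (simp_all add: field_simps)
  have 1: "summable (\<lambda>k. measure_pmf.prob (W (k * m)) {w. 1 * len w < ((L - \<epsilon>) * real m) * real k})"
    by (rule one_sided_deviation[where c = "?e m - C"]) (use lower m' in auto)
  have 2: "summable (\<lambda>k. measure_pmf.prob (W (k * m)) {w. - 1 * len w < (- ((L + \<epsilon>) * real m)) * real k})"
    by (rule one_sided_deviation[where c = "- ?e m"]) (use upper m' in auto)
  have le: "measure_pmf.prob (W (k * m)) {w. \<not> \<bar>len w - L * real (k * m)\<bar> \<le> real (k * m) * \<epsilon>}
      \<le> measure_pmf.prob (W (k * m)) {w. 1 * len w < ((L - \<epsilon>) * real m) * real k}
       + measure_pmf.prob (W (k * m)) {w. - 1 * len w < (- ((L + \<epsilon>) * real m)) * real k}" for k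
  proof -
    have "{w. \<not> \<bar>len w - L * real (k * m)\<bar> \<le> real (k * m) * \<epsilon>}
      \<subseteq> {w. 1 * len w < ((L - \<epsilon>) * real m) * real k} \<union> {w. - 1 * len w < (- ((L + \<epsilon>) * real m)) * real k}"
      by (auto simp: abs_le_iff algebra_simps)
    then show ?thesis by (intro order_trans[OF measure_pmf.finite_measure_mono measure_Un_le]) auto
  qed
  have "summable (\<lambda>k. measure_pmf.prob (W (k * m)) {w. \<not> \<bar>len w - L * real (k * m)\<bar> \<le> real (k * m) * \<epsilon>})"
    by (rule summable_comparison_test'[OF summable_add[OF 1 2], where N = 0]) (use le in auto)
  with m(1) show thesis by (rule that)
qed

end

section \<open>Translation length along a sample path\<close>

lemma half_div_limit: "(\<lambda>n. real (n div 2) / real n) \<longlonglongrightarrow> 1 / 2"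
proof (rule LIMSEQ_I)
  fix e :: real assume e: "0 < e"
  obtain N :: nat where N: "1 / e < real N" using reals_Archimedean2 by blast
  show "\<exists>N. \<forall>n\<ge>N. norm (real (n div 2) / real n - 1 / 2) < e"
  proof (intro exI allI impI)
    fix n assume n: "Suc N \<le> n"
    have "real n = 2 * real (n div 2) + real (n mod 2)" by (metis mult_div_mod_eq of_nat_add of_nat_mult of_nat_numeral)
    moreover have "real (n mod 2) \<le> 1" by simp
    moreover have "1 < e * real n"
    proof -
      have "1 / e < real n" using N n by linarith
      then show ?thesis using e by (simp add: field_simps)
    qed
    ultimately have "\<bar>2 * real (n div 2) - real n\<bar> < 2 * (e * real n)" by linarith
    moreover have "real (n div 2) / real n - 1 / 2 = (2 * real (n div 2) - real n) / (2 * real n)"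
      using n by (simp add: field_simps)
    ultimately show "norm (real (n div 2) / real n - 1 / 2) < e"
      using n by (simp add: field_simps)
  qed
qed

lemma (in hyperbolic_action) transl_len_average_limit:
  fixes w b :: "nat \<Rightarrow> 'g"
  assumes w: "\<And>n. w n \<in> carrier G" and b: "\<And>n. b n \<in> carrier G"
    and split: "\<And>n. w n = w (n div 2) \<otimes> b n"
    and L: "L > 0" and lim: "(\<lambda>n. len (w n) / real n) \<longlonglongrightarrow> L"
    and gp1: "\<And>j. \<forall>\<^sub>F n in sequentially. gp (act (inv (w (n div 2))) x) (act (b n) x) \<le> real n / real (Suc j)"
    and gp2: "\<And>j. \<forall>\<^sub>F n in sequentially. gp (act (w (n div 2)) x) (act (inv (b n)) x) \<le> real n / real (Suc j)"
  shows "(\<lambda>n. transl_len G act x (w n) / real n) \<longlonglongrightarrow> L"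
proof (rule LIMSEQ_I)
  fix e :: real assume e: "0 < e"
  \<comment> \<open>Both halves of the path have length about nL/2, so an error 2\<epsilon> below
    L/4 meets the conditions of \<open>transl_len_mult_ge\<close>. An \<epsilon> below e/8 keeps its
    loss under e/4, beside e/4 for the hyperbolicity constant and e/4 for the length.\<close>
  obtain j where j0: "inverse (real (Suc j)) < min (L / 8) (e / 8)"
    using reals_Archimedean[of "min (L / 8) (e / 8)"] e L by auto
  define \<epsilon> where "\<epsilon> = 1 / real (Suc j)"
  have \<epsilon>: "0 < \<epsilon>" "\<epsilon> < L / 8" "\<epsilon> < e / 8" using j0 unfolding \<epsilon>_def by (auto simp: inverse_eq_divide)
  have half: "(\<lambda>n. len (w (n div 2)) / real n) \<longlonglongrightarrow> L * (1 / 2)"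
  proof -
    have "filterlim (\<lambda>n::nat. n div 2) sequentially sequentially"
      unfolding filterlim_at_top
    proof
      fix Z :: nat
      show "\<forall>\<^sub>F n in sequentially. Z \<le> n div 2"
        using eventually_ge_at_top[of "2 * Z"] by eventually_elim auto
    qed
    then have "(\<lambda>n. len (w (n div 2)) / real (n div 2) * (real (n div 2) / real n)) \<longlonglongrightarrow> L * (1 / 2)"
      by (intro tendsto_mult half_div_limit filterlim_compose[OF lim])
    moreover have "\<forall>\<^sub>F n in sequentially. len (w (n div 2)) / real (n div 2) * (real (n div 2) / real n) = len (w (n div 2)) / real n"
      using eventually_ge_at_top[of 2] by eventually_elim auto
    ultimately show ?thesis by (rule Lim_transform_eventually)
  qed
  have const: "(\<lambda>n. c / real n) \<longlonglongrightarrow> 0" for c :: real by (rule lim_const_over_n)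
  have "\<forall>\<^sub>F n in sequentially. L / 4 < len (w (n div 2)) / real n"
    using L by (intro order_tendstoD(1)[OF half]) auto
  moreover have "\<forall>\<^sub>F n in sequentially. L / 4 < len (w n) / real n - len (w (n div 2)) / real n"
    using L by (intro order_tendstoD(1)[OF tendsto_diff[OF lim half]]) auto
  moreover have "\<forall>\<^sub>F n in sequentially. 2 * \<epsilon> + 2 * \<delta> / real n < L / 4"
    using \<epsilon> by (intro order_tendstoD(2)[OF tendsto_add[OF tendsto_const const]]) auto
  moreover have "\<forall>\<^sub>F n in sequentially. 6 * \<delta> / real n < e / 4"
    using e by (intro order_tendstoD(2)[OF const]) auto
  moreover have "\<forall>\<^sub>F n in sequentially. L - e / 4 < len (w n) / real n"
    using e by (intro order_tendstoD(1)[OF lim]) auto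
  moreover have "\<forall>\<^sub>F n in sequentially. len (w n) / real n < L + e"
    using e by (intro order_tendstoD(2)[OF lim]) auto
  ultimately have "\<forall>\<^sub>F n in sequentially. norm (transl_len G act x (w n) / real n - L) < e"
    using gp1[of j] gp2[of j] eventually_gt_at_top[of 0]
  proof eventually_elim
    case (elim n)
    let ?a = "w (n div 2)"
    have n: "real n > 0" using elim by simp
    have \<eta>: "real n / real (Suc j) = \<epsilon> * real n" unfolding \<epsilon>_def by simp
    have k: "2 * (\<epsilon> * real n) + 2 * \<delta> < L / 4 * real n" using elim(3) n by (simp add: field_simps)
    have "2 * (\<epsilon> * real n) + 2 * \<delta> < len ?a" using elim(1) k n by (simp add: field_simps)
    moreover have "2 * (\<epsilon> * real n) + 2 * \<delta> < len (?a \<otimes> b n) - len ?a"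
      using elim(2) k n unfolding split[of n, symmetric] by (simp add: field_simps)
    ultimately have "len (w n) - 2 * (\<epsilon> * real n) - 6 * \<delta> \<le> transl_len G act x (w n)"
      using transl_len_mult_ge[OF w b, of "n div 2" n "\<epsilon> * real n"] elim(7,8)
      unfolding \<eta> split[of n, symmetric] by blast
    then have "(len (w n) - 2 * (\<epsilon> * real n) - 6 * \<delta>) / real n \<le> transl_len G act x (w n) / real n"
      by (rule divide_right_mono) simp
    then have "len (w n) / real n - 2 * \<epsilon> - 6 * \<delta> / real n \<le> transl_len G act x (w n) / real n"
      using n by (simp add: diff_divide_distrib)
    moreover have "transl_len G act x (w n) / real n \<le> len (w n) / real n"
      using transl_len_le[OF w[of n]] n by (simp add: divide_right_mono)
    ultimately show ?case using elim(4,5,6) \<epsilon>(3) by (simp add: abs_less_iff)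
  qed
  then show "\<exists>N. \<forall>n\<ge>N. norm (transl_len G act x (w n) / real n - L) < e"
    by (simp add: eventually_sequentially)
qed

context nonelementary_walk
begin

lemma prob_replicate_gprod:
  "measure_pmf.prob (replicate_pmf n \<nu>) {l. P (gprod G l)} = measure_pmf.prob (W n) {w. P w}"
  by (simp add: walk_def vimage_def)

text \<open>Each product pairs a walk point of one half with a point determined by the other half.
  With the latter half fixed, \<open>gp_tail\<close> applies uniformly, so the probabilities are
  summable in \<open>n\<close>. The first claim fixes the prefix, the second the suffix.\<close>

lemma halves_gp_small:
  fixes c :: real
  assumes c: "c > 0"
  shows "AE \<omega> in stream_space (measure_pmf \<nu>). \<forall>\<^sub>F n in sequentially.
      gp (act (inv (gprod G (take (n div 2) (stake n \<omega>)))) x) (act (gprod G (drop (n div 2) (stake n \<omega>))) x) \<le> c * real n"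
    and "AE \<omega> in stream_space (measure_pmf \<nu>). \<forall>\<^sub>F n in sequentially.
      gp (act (gprod G (take (n div 2) (stake n \<omega>))) x) (act (inv (gprod G (drop (n div 2) (stake n \<omega>)))) x) \<le> c * real n"
proof -
  obtain s K where s: "s > 0"
    and tail: "\<And>n y t. measure_pmf.prob (W n) {w. t < gp y (act w x)} \<le> K * exp (- s * t)"
    by (rule gp_tail) blast
  have sum: "summable (\<lambda>n. K * exp (- (s * c) * real n))"
    using s c by (intro summable_exp_neg) simp
  define P where "P n k l \<longleftrightarrow> c * real n < gp (act (inv (gprod G k)) x) (act (gprod G l) x)" for n k l
  define Q where "Q n k l \<longleftrightarrow> c * real n < gp (act (gprod G k) x) (act (inv (gprod G l)) x)" for n k l
  have P: "measure_pmf.prob (replicate_pmf n \<nu>) {l. P n (take (n div 2) l) (drop (n div 2) l)} \<le> K * exp (- (s * c) * real n)" for n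
  proof -
    have "measure_pmf.prob (replicate_pmf m \<nu>) {l. P n k l} \<le> K * exp (- (s * c) * real n)" for m k
      using tail[of m "c * real n" "act (inv (gprod G k)) x"]
        prob_replicate_gprod[of m "\<lambda>w. c * real n < gp (act (inv (gprod G k)) x) (act w x)"]
      unfolding P_def by (simp add: mult_ac)
    then show ?thesis
      using pmf_replicate_split[of "n div 2" \<nu> "n - n div 2" "P n" "K * exp (- (s * c) * real n)"] by simp
  qed
  have Q: "measure_pmf.prob (replicate_pmf n \<nu>) {l. Q n (take (n div 2) l) (drop (n div 2) l)} \<le> K * exp (- (s * c) * real n)" for n
  proof -
    have "measure_pmf.prob (replicate_pmf m \<nu>) {k. Q n k l} \<le> K * exp (- (s * c) * real n)" for m l
      using tail[of m "c * real n" "act (inv (gprod G l)) x"]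
        prob_replicate_gprod[of m "\<lambda>w. c * real n < gp (act w x) (act (inv (gprod G l)) x)"]
      unfolding Q_def by (simp add: mult_ac gromov_product_commute)
    then show ?thesis
      using pmf_replicate_split'[of "n - n div 2" \<nu> "n div 2" "Q n" "K * exp (- (s * c) * real n)"] by simp
  qed
  have "AE \<omega> in stream_space (measure_pmf \<nu>). \<forall>\<^sub>F n in sequentially.
      \<not> P n (take (n div 2) (stake n \<omega>)) (drop (n div 2) (stake n \<omega>))"
    by (rule AE_stake_eventually[where f = "\<lambda>n. n"])
      (rule summable_comparison_test'[OF sum, where N = 0], use P in simp)
  then show "AE \<omega> in stream_space (measure_pmf \<nu>). \<forall>\<^sub>F n in sequentially.
      gp (act (inv (gprod G (take (n div 2) (stake n \<omega>)))) x) (act (gprod G (drop (n div 2) (stake n \<omega>))) x) \<le> c * real n"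
    by (simp add: P_def not_less)
  have "AE \<omega> in stream_space (measure_pmf \<nu>). \<forall>\<^sub>F n in sequentially.
      \<not> Q n (take (n div 2) (stake n \<omega>)) (drop (n div 2) (stake n \<omega>))"
    by (rule AE_stake_eventually[where f = "\<lambda>n. n"])
      (rule summable_comparison_test'[OF sum, where N = 0], use Q in simp)
  then show "AE \<omega> in stream_space (measure_pmf \<nu>). \<forall>\<^sub>F n in sequentially.
      gp (act (gprod G (take (n div 2) (stake n \<omega>))) x) (act (inv (gprod G (drop (n div 2) (stake n \<omega>)))) x) \<le> c * real n"
    by (simp add: Q_def not_less)
qed

lemma drift_and_translation_length:
  "\<exists>L>0. AE \<omega> in stream_space (measure_pmf \<nu>).
     (\<lambda>n. len (rw_pos G \<omega> n) / real n) \<longlonglongrightarrow> L \<and>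
     (\<lambda>n. transl_len G act x (rw_pos G \<omega> n) / real n) \<longlonglongrightarrow> L"
proof -
  let ?S = "stream_space (measure_pmf \<nu>)"
  obtain L C where L: "L > 0" "(\<lambda>n. measure_pmf.expectation (W n) len / real n) \<longlonglongrightarrow> L"
    "\<And>n y. measure_pmf.expectation (W n) len - C \<le> measure_pmf.expectation (W n) (displ y)"
    "\<And>n y. measure_pmf.expectation (W n) (displ y) \<le> measure_pmf.expectation (W n) len"
    by (rule drift) blast
  \<comment> \<open>The block length may vary with \<open>j\<close>; only countably many almost sure
    events are then intersected.\<close>
  define dev where "dev j m \<longleftrightarrow> (AE \<omega> in ?S. \<forall>\<^sub>F k in sequentially.
      \<bar>len (rw_pos G \<omega> (k * m)) - L * real (k * m)\<bar> \<le> real (k * m) / real (Suc j))" for j m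
  have "\<exists>m>0. dev j m" for j
  proof -
    obtain m where m: "m > 0" "summable (\<lambda>k. measure_pmf.prob (W (k * m))
        {w. \<not> \<bar>len w - L * real (k * m)\<bar> \<le> real (k * m) * (1 / real (Suc j))})"
      by (rule len_deviation[OF L(2-4), of "1 / real (Suc j)"]) auto
    have eq: "measure_pmf.prob (W (k * m)) {w. \<not> \<bar>len w - L * real (k * m)\<bar> \<le> real (k * m) * (1 / real (Suc j))}
        = measure_pmf.prob (replicate_pmf (k * m) \<nu>)
            {l. \<not> \<bar>len (gprod G l) - L * real (k * m)\<bar> \<le> real (k * m) * (1 / real (Suc j))}" for k
      by (rule prob_replicate_gprod[symmetric])
    have "AE \<omega> in ?S. \<forall>\<^sub>F k in sequentially.
        \<not> \<not> \<bar>len (gprod G (stake (k * m) \<omega>)) - L * real (k * m)\<bar> \<le> real (k * m) * (1 / real (Suc j))"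
      by (rule AE_stake_eventually[where f = "\<lambda>k. k * m" and
            P = "\<lambda>k l. \<not> \<bar>len (gprod G l) - L * real (k * m)\<bar> \<le> real (k * m) * (1 / real (Suc j))"])
        (rule m(2)[unfolded eq])
    with m(1) show ?thesis by (auto simp: rw_pos_def dev_def)
  qed
  then obtain m where m: "\<And>j. m j > 0" "\<And>j. dev j (m j)" by metis
  have pos: "1 / real (Suc j) > 0" for j by simp
  have "AE \<omega> in ?S. \<forall>j. \<forall>\<^sub>F k in sequentially.
      \<bar>len (rw_pos G \<omega> (k * m j)) - L * real (k * m j)\<bar> \<le> real (k * m j) / real (Suc j)"
    using m(2) unfolding dev_def by (simp add: AE_all_countable)
  moreover have "AE \<omega> in ?S. \<forall>j. \<forall>\<^sub>F n in sequentially.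
      gp (act (inv (gprod G (take (n div 2) (stake n \<omega>)))) x) (act (gprod G (drop (n div 2) (stake n \<omega>))) x)
      \<le> 1 / real (Suc j) * real n"
    using halves_gp_small(1)[OF pos] unfolding AE_all_countable by blast
  moreover have "AE \<omega> in ?S. \<forall>j. \<forall>\<^sub>F n in sequentially.
      gp (act (gprod G (take (n div 2) (stake n \<omega>))) x) (act (inv (gprod G (drop (n div 2) (stake n \<omega>)))) x)
      \<le> 1 / real (Suc j) * real n"
    using halves_gp_small(2)[OF pos] unfolding AE_all_countable by blast
  ultimately have "AE \<omega> in ?S.
     (\<lambda>n. len (rw_pos G \<omega> n) / real n) \<longlonglongrightarrow> L \<and>
     (\<lambda>n. transl_len G act x (rw_pos G \<omega> n) / real n) \<longlonglongrightarrow> L"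
    \<comment> \<open>Discards paths with an increment outside the support, so that all prefixes lie
      in \<open>carrier G\<close> and all steps obey the bound \<open>D\<close>.\<close>
    using AE_stake_support
  proof eventually_elim
    case (elim \<omega>)
    have steps: "set (stake n \<omega>) \<subseteq> set_pmf \<nu>" for n
      using elim(4)[rule_format, of n] by (auto simp: set_replicate_pmf)
    have "set (stake r (sdrop n \<omega>)) \<subseteq> set (stake (n + r) \<omega>)" for n r
      unfolding stake_add[of n \<omega> r, symmetric] set_append by blast
    then have later: "set (stake r (sdrop n \<omega>)) \<subseteq> set_pmf \<nu>" for n r using steps by blast
    have lim: "(\<lambda>n. len (rw_pos G \<omega> n) / real n) \<longlonglongrightarrow> L"
    proof (rule lipschitz_average_limit[where D = D])
      fix n r
      let ?a = "gprod G (stake n \<omega>)" and ?b = "gprod G (stake r (sdrop n \<omega>))"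
      have ab: "?a \<in> carrier G" "?b \<in> carrier G" using steps[of n] later[of r n] supp by (auto intro!: gprod_closed)
      have "rw_pos G \<omega> (n + r) = ?a \<otimes> ?b"
        unfolding rw_pos_def stake_add[of n \<omega> r, symmetric] using steps[of n] later[of r n] supp by (intro gprod_append) auto
      moreover have "\<bar>len (?a \<otimes> ?b) - len ?a\<bar> \<le> len ?b"
        using len_mult[OF ab] dist_triangle[of x "act ?a x" "act (?a \<otimes> ?b) x"] ab
        by (simp add: act_mult dist_commute abs_le_iff)
      moreover have "len ?b \<le> real r * D"
        using len_gprod_le[of "stake r (sdrop n \<omega>)" D] later[of r n] supp step_le by auto
      ultimately show "\<bar>len (rw_pos G \<omega> (n + r)) - len (rw_pos G \<omega> n)\<bar> \<le> real r * D"
        unfolding rw_pos_def by simp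
    next
      fix j
      show "\<exists>m>0. \<forall>\<^sub>F k in sequentially.
          \<bar>len (rw_pos G \<omega> (k * m)) - L * real (k * m)\<bar> \<le> real (k * m) / real (Suc j)"
        using m(1) elim(1) by blast
    qed
    have take_half: "take (n div 2) (stake n \<omega>) = stake (n div 2) \<omega>" for n by (simp add: take_stake min_def)
    have "(\<lambda>n. transl_len G act x (rw_pos G \<omega> n) / real n) \<longlonglongrightarrow> L"
    proof (rule transl_len_average_limit[where b = "\<lambda>n. gprod G (drop (n div 2) (stake n \<omega>))"])
      fix n
      have sub: "set (drop (n div 2) (stake n \<omega>)) \<subseteq> carrier G" "set (stake m \<omega>) \<subseteq> carrier G" for m
        using steps supp set_drop_subset[of "n div 2" "stake n \<omega>"] by blast+
      show "rw_pos G \<omega> n \<in> carrier G" "gprod G (drop (n div 2) (stake n \<omega>)) \<in> carrier G"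
        unfolding rw_pos_def using sub by auto
      show "rw_pos G \<omega> n = rw_pos G \<omega> (n div 2) \<otimes> gprod G (drop (n div 2) (stake n \<omega>))"
        unfolding rw_pos_def
        using gprod_append[OF sub(2)[of "n div 2"] sub(1)] append_take_drop_id[of "n div 2" "stake n \<omega>"]
        unfolding take_half by simp
    qed (use L(1) lim elim(2,3) in \<open>simp_all add: rw_pos_def take_half\<close>)
    with lim show ?case by blast
  qed
  with L(1) show ?thesis by blast
qed

end

theorem theorem4p1:
  fixes G :: "('g, 'b) monoid_scheme"
    and act :: "'g \<Rightarrow> 'a::metric_space \<Rightarrow> 'a"
    and x :: 'a
    and \<delta> :: real
    and \<mu> :: "'g pmf"
  assumes "group G"
    and "isometric_action G act"
    and "geodesic_space TYPE('a)"
    and "delta_hyperbolic \<delta> TYPE('a)"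
    and "set_pmf \<mu> \<subseteq> carrier G"
    and "non_elementary G act x \<mu>"
    and "bounded ((\<lambda>g. act g x) ` set_pmf \<mu>)"
  shows "\<exists>L>0. AE \<omega> in stream_space (measure_pmf \<mu>).
           (\<lambda>n. dist x (act (rw_pos G \<omega> n) x) / real n) \<longlonglongrightarrow> L \<and>
           (\<lambda>n. transl_len G act x (rw_pos G \<omega> n) / real n) \<longlonglongrightarrow> L"
proof -
  obtain D where D: "\<forall>y\<in>(\<lambda>g. act g x) ` set_pmf \<mu>. dist x y \<le> D"
    using bounded_any_center[of _ x] assms(7) by blast
  interpret group G by fact
  from D interpret nonelementary_walk G act x \<delta> \<mu> D
    using assms by (unfold_locales; auto)
  show ?thesis by (rule drift_and_translation_length)
qed

end
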